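(* Assume (A1)-(A4) of the context and that $F$ satisfies the strict saddle property. Let $\alpha<\beta/\rho$ and $\alpha\in\left(0,\frac1{1+L_S}\right)$. Let $\{(x^k,\epsilon^k)\}$ be the sequence generated by DIRL$_2$. Then the set of initial points attracted by strict saddle points (i.e. the initial points $(x^0,\epsilon^0)$ for which $(x^k,\epsilon^k)$ converges to $(x^*,0)$ with $x^*$ a strict saddle point of $F$) has zero Lebesgue measure.
   Context: Let $f:\mathbb R^n\to\mathbb R$ be twice continuously differentiable, $\lambda>0$, $F(x)=f(x)+\lambda\sum_{i=1}^n r(|x_i|)$, and $F(x,\epsilon)=f(x)+\lambda\sum_{i=1}^n r\big(\sqrt{x_i^2+\epsilon_i^2}\big)$. (A1) $r:[0,\infty)\to\mathbb R$ is continuous and concave, $r(0)=0$, $C^2$ on $(0,\infty)$, $r'(t)\ge0$ for all $t>0$, and $r'(0^+):=\lim_{t\to0^+}r'(t)\in(0,\infty]$. (A2) Every $x$ with $0\in\partial F(x)$ satisfies $0\in\mathrm{rint}\,\partial F(x)$ ($\partial F$ the regular subdifferential, $\mathrm{rint}$ the relative interior). (A3) Given the initial point $(x^0,\epsilon^0)$ and $F^0=F(x^0,\epsilon^0)$, the level set $\mathcal L(F^0)=\{x:F(x)\le F^0\}$ is bounded. (A4) $\lim_{z\to0^+}r'(z)=\infty$ and $\lim_{z\to0^+}z\,r''(z)/r'(z)^2=0$. $\mathcal I(x)=\{i:x_i\ne0\}$, $\mathcal J(x)=\{i:x_i=0\}$; $\nabla^2_{\mathcal I^*\mathcal I^*}F(x^*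 )$, with $\mathcal I^*=\mathcal I(x^* )$, is the Hessian of $F$ at $x^*$ with respect to the nonzero coordinates. A point $x^*$ is stationary if $\nabla_i f(x^* )=-\lambda\,\mathrm{sign}(x_i^* )r'(|x_i^*|)$ for $i\in\mathcal I(x^* )$ and $\nabla_i f(x^* )\in(-\lambda r'(0^+),\lambda r'(0^+))$ for $i\in\mathcal J(x^* )$. A stationary point $x^*$ is a strict saddle point if $d^T\nabla^2_{\mathcal I^*\mathcal I^*}F(x^* )d<0$ for some $d\in\mathbb R^{|\mathcal I^*|}$. $F$ has the strict saddle property if every stationary point is a strict saddle point or a local minimum. DIRL$_2$ (parameters $\alpha,\mu\in(0,1)$, $\beta>\alpha L_{\nabla f}/2$ with $L_{\nabla f}$ a Lipschitz constant of $\nabla f$ on $\mathcal L(F^0)$): from $(x^0,\epsilon^0)$ with $\epsilon^0>0$ componentwise, iterate $(x^{k+1},\epsilon^{k+1})=((1-\alpha)x^k+\alpha S^x(x^k,\epsilon^k),\,(1-\alpha(1-\mu))\epsilon^k)$, where $S^x_i(x,\epsilon)=\big(1+\frac{2\lambda}\beta u(x_i,\epsilon_i)\big)^{-1}\big(x_i-\frac1\beta\nabla_i f(x)\big)$, $u(x_i,\epsilon_i)=\dfrac{r'(\sqrt{x_i^2+\epsilon_i^2})}{2\sqrt{x_i^2+\epsilon_i^2}}$ for $(x_i,\epsilon_i)\ne(0,0)$, and $S^x_i(x,\epsilon)=0$ if $(x_i,\epsilon_i)=(0,0)$. (Equivalently $S^x(x^k,\epsilon^k)=\arg\min_y\{\nabla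 f(x^k)^Ty+\frac\beta2\|x^k-y\|^2+\lambda\sum_i u(x_i^k,\epsilon_i^k)y_i^2\}$.) Constants: $\rho>0$ satisfies $\|\nabla^2_{\mathcal I^*\mathcal I^*}F(x^* )\|\le\rho$ for every stationary point $x^*\in\mathcal L(F^0)$; $L_S$ is the Lipschitz constant on $\mathcal L(F^0)$ of the map $S(x,\epsilon)=(S^x(x,\epsilon),\mu\epsilon)$. *)

theory Defs
  imports "HOL-Analysis.Analysis"
begin

subsection \<open>Calculus on \<open>real ^ 'n\<close>\<close>

definition partial :: "'n::finite \<Rightarrow> (real ^ 'n \<Rightarrow> real) \<Rightarrow> real ^ 'n \<Rightarrow> real" where
  "partial i g x = deriv (\<lambda>t. g (x + t *\<^sub>R axis i 1)) 0"

definition gradient :: "(real ^ 'n::finite \<Rightarrow> real) \<Rightarrow> real ^ 'n \<Rightarrow> real ^ 'n" where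
  "gradient f x = (\<chi> i. partial i f x)"

definition twice_cont_diff :: "(real ^ 'n::finite \<Rightarrow> real) \<Rightarrow> bool" where
  "twice_cont_diff f \<longleftrightarrow>
     (\<forall>x. f differentiable (at x)) \<and>
     (\<exists>H :: real ^ 'n \<Rightarrow> real ^ 'n ^ 'n.
        (\<forall>x. (gradient f has_derivative (\<lambda>h. H x *v h)) (at x)) \<and> continuous_on UNIV H)"

definition regular_subdiff :: "(real ^ 'n::finite \<Rightarrow> real) \<Rightarrow> real ^ 'n \<Rightarrow> (real ^ 'n) set" where
  "regular_subdiff F x =
     {v. Liminf (at x) (\<lambda>y. ereal ((F y - F x - v \<bullet> (y - x)) / norm (y - x))) \<ge> 0}"

definition local_min :: "(real ^ 'n::finite \<Rightarrow> real) \<Rightarrow> real ^ 'n \<Rightarrow> bool" where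
  "local_min F x \<longleftrightarrow> (\<forall>\<^sub>F y in nhds x. F x \<le> F y)"


subsection \<open>The regularized objective\<close>

definition objective ::
    "(real ^ 'n::finite \<Rightarrow> real) \<Rightarrow> (real \<Rightarrow> real) \<Rightarrow> real \<Rightarrow> real ^ 'n \<Rightarrow> real" where
  "objective f r lam x = f x + lam * (\<Sum>i\<in>UNIV. r \<bar>x $ i\<bar>)"

definition smoothed_objective ::
    "(real ^ 'n::finite \<Rightarrow> real) \<Rightarrow> (real \<Rightarrow> real) \<Rightarrow> real \<Rightarrow> real ^ 'n \<Rightarrow> real ^ 'n \<Rightarrow> real" where
  "smoothed_objective f r lam x e =
     f x + lam * (\<Sum>i\<in>UNIV. r (sqrt ((x $ i)\<^sup>2 + (e $ i)\<^sup>2)))"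

definition level_set ::
    "(real ^ 'n::finite \<Rightarrow> real) \<Rightarrow> (real \<Rightarrow> real) \<Rightarrow> real \<Rightarrow> real ^ 'n \<Rightarrow> real ^ 'n \<Rightarrow> (real ^ 'n) set" where
  "level_set f r lam x0 e0 = {x. objective f r lam x \<le> smoothed_objective f r lam x0 e0}"


subsection \<open>Assumptions on the regularizer and the objective\<close>

text \<open>Only the restriction of \<open>r\<close> to the nonnegative reals is meaningful;
  \<open>deriv r\<close> and \<open>deriv (deriv r)\<close> are used at positive arguments only.\<close>

definition A1 :: "(real \<Rightarrow> real) \<Rightarrow> bool" where
  "A1 r \<longleftrightarrow>
     continuous_on {0..} r \<and> concave_on {0..} r \<and> r 0 = 0 \<and>
     (\<forall>t>0. r differentiable (at t)) \<and>
     (\<forall>t>0. deriv r differentiable (at t)) \<and>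
     continuous_on {0<..} (deriv (deriv r)) \<and>
     (\<forall>t>0. deriv r t \<ge> 0) \<and>
     (\<exists>l>0. ((\<lambda>t. ereal (deriv r t)) \<longlongrightarrow> l) (at_right 0))"

definition deriv_at_zero :: "(real \<Rightarrow> real) \<Rightarrow> ereal" where
  "deriv_at_zero r = Lim (at_right 0) (\<lambda>t. ereal (deriv r t))"

definition A2 :: "(real ^ 'n::finite \<Rightarrow> real) \<Rightarrow> (real \<Rightarrow> real) \<Rightarrow> real \<Rightarrow> bool" where
  "A2 f r lam \<longleftrightarrow>
     (\<forall>x. 0 \<in> regular_subdiff (objective f r lam) x \<longrightarrow>
          0 \<in> rel_interior (regular_subdiff (objective f r lam) x))"

definition A3 ::
    "(real ^ 'n::finite \<Rightarrow> real) \<Rightarrow> (real \<Rightarrow> real) \<Rightarrow> real \<Rightarrow> real ^ 'n \<Rightarrow> real ^ 'n \<Rightarrow> bool" where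
  "A3 f r lam x0 e0 \<longleftrightarrow> bounded (level_set f r lam x0 e0)"

definition A4 :: "(real \<Rightarrow> real) \<Rightarrow> bool" where
  "A4 r \<longleftrightarrow>
     filterlim (deriv r) at_top (at_right 0) \<and>
     ((\<lambda>z. z * deriv (deriv r) z / (deriv r z)\<^sup>2) \<longlongrightarrow> 0) (at_right 0)"


subsection \<open>Stationary points and strict saddle points\<close>

definition nz_coords :: "real ^ 'n::finite \<Rightarrow> 'n set" where
  "nz_coords x = {i. x $ i \<noteq> 0}"

text \<open>The Hessian with respect to the nonzero coordinates is padded with zeros to a full matrix.
  This changes neither its operator norm nor its values on vectors supported on
  \<open>nz_coords x\<close>, which stand for the vectors with \<open>card (nz_coords x)\<close> entries.\<close>

definition hessian_nz ::
    "(real ^ 'n::finite \<Rightarrow> real) \<Rightarrow> (real \<Rightarrow> real) \<Rightarrow> real \<Rightarrow> real ^ 'n \<Rightarrow> real ^ 'n ^ 'n" where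
  "hessian_nz f r lam x =
     (\<chi> i j. if i \<in> nz_coords x \<and> j \<in> nz_coords x
             then partial i (partial j (objective f r lam)) x else 0)"

definition stationary ::
    "(real ^ 'n::finite \<Rightarrow> real) \<Rightarrow> (real \<Rightarrow> real) \<Rightarrow> real \<Rightarrow> real ^ 'n \<Rightarrow> bool" where
  "stationary f r lam x \<longleftrightarrow>
     (\<forall>i\<in>nz_coords x. gradient f x $ i = - lam * sgn (x $ i) * deriv r \<bar>x $ i\<bar>) \<and>
     (\<forall>i. i \<notin> nz_coords x \<longrightarrow>
        ereal (gradient f x $ i)
          \<in> {- (ereal lam * deriv_at_zero r) <..< ereal lam * deriv_at_zero r})"

definition strict_saddle ::
    "(real ^ 'n::finite \<Rightarrow> real) \<Rightarrow> (real \<Rightarrow> real) \<Rightarrow> real \<Rightarrow> real ^ 'n \<Rightarrow> bool" where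
  "strict_saddle f r lam x \<longleftrightarrow>
     stationary f r lam x \<and>
     (\<exists>d. (\<forall>i. i \<notin> nz_coords x \<longrightarrow> d $ i = 0) \<and> d \<bullet> (hessian_nz f r lam x *v d) < 0)"

definition strict_saddle_property ::
    "(real ^ 'n::finite \<Rightarrow> real) \<Rightarrow> (real \<Rightarrow> real) \<Rightarrow> real \<Rightarrow> bool" where
  "strict_saddle_property f r lam \<longleftrightarrow>
     (\<forall>x. stationary f r lam x \<longrightarrow>
          strict_saddle f r lam x \<or> local_min (objective f r lam) x)"


subsection \<open>The damped iteratively reweighted \<open>\<ell>\<^sub>2\<close> iteration\<close>

definition weight :: "(real \<Rightarrow> real) \<Rightarrow> real \<Rightarrow> real \<Rightarrow> real" where
  "weight r s e = deriv r (sqrt (s\<^sup>2 + e\<^sup>2)) / (2 * sqrt (s\<^sup>2 + e\<^sup>2))"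

definition Sx ::
    "(real ^ 'n::finite \<Rightarrow> real) \<Rightarrow> (real \<Rightarrow> real) \<Rightarrow> real \<Rightarrow> real
      \<Rightarrow> real ^ 'n \<Rightarrow> real ^ 'n \<Rightarrow> real ^ 'n" where
  "Sx f r lam \<beta> x e =
     (\<chi> i. if (x $ i, e $ i) = (0, 0) then 0
           else inverse (1 + 2 * lam / \<beta> * weight r (x $ i) (e $ i))
                  * (x $ i - gradient f x $ i / \<beta>))"

definition Smap ::
    "(real ^ 'n::finite \<Rightarrow> real) \<Rightarrow> (real \<Rightarrow> real) \<Rightarrow> real \<Rightarrow> real \<Rightarrow> real
      \<Rightarrow> (real ^ 'n) \<times> (real ^ 'n) \<Rightarrow> (real ^ 'n) \<times> (real ^ 'n)" where
  "Smap f r lam \<beta> \<mu> = (\<lambda>(x, e). (Sx f r lam \<beta> x e, \<mu> *\<^sub>R e))"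

definition dirl2_step ::
    "(real ^ 'n::finite \<Rightarrow> real) \<Rightarrow> (real \<Rightarrow> real) \<Rightarrow> real \<Rightarrow> real \<Rightarrow> real \<Rightarrow> real
      \<Rightarrow> (real ^ 'n) \<times> (real ^ 'n) \<Rightarrow> (real ^ 'n) \<times> (real ^ 'n)" where
  "dirl2_step f r lam \<alpha> \<beta> \<mu> =
     (\<lambda>(x, e). ((1 - \<alpha>) *\<^sub>R x + \<alpha> *\<^sub>R Sx f r lam \<beta> x e, (1 - \<alpha> * (1 - \<mu>)) *\<^sub>R e))"

definition dirl2 ::
    "(real ^ 'n::finite \<Rightarrow> real) \<Rightarrow> (real \<Rightarrow> real) \<Rightarrow> real \<Rightarrow> real \<Rightarrow> real \<Rightarrow> real
      \<Rightarrow> (real ^ 'n) \<times> (real ^ 'n) \<Rightarrow> nat \<Rightarrow> (real ^ 'n) \<times> (real ^ 'n)" where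
  "dirl2 f r lam \<alpha> \<beta> \<mu> p k = (dirl2_step f r lam \<alpha> \<beta> \<mu> ^^ k) p"

text \<open>The iterates \<open>(x, e)\<close> started at \<open>(x0, e0)\<close> satisfy \<open>0 \<le> e \<le> e0\<close> componentwise, so
  this is the set of pairs over the level set on which the map \<open>Smap\<close> is required to be
  Lipschitz.\<close>

definition lip_domain ::
    "(real ^ 'n::finite \<Rightarrow> real) \<Rightarrow> (real \<Rightarrow> real) \<Rightarrow> real \<Rightarrow> real ^ 'n \<Rightarrow> real ^ 'n
      \<Rightarrow> ((real ^ 'n) \<times> (real ^ 'n)) set" where
  "lip_domain f r lam x0 e0 = level_set f r lam x0 e0 \<times> cbox 0 e0"

end

theory Submission
  imports Defs
begin

text \<open>
  Let \<open>T\<close> be the iteration map. It is strictly differentiable at \<open>(x, 0)\<close> for a strict saddle \<open>x\<close>, and a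
  quadratic form \<open>V\<close> that is positive somewhere satisfies \<open>V (DT h) \<ge> \<gamma> V h + \<delta> \<bar>h\<bar>\<^sup>2\<close> with \<open>\<gamma> > 1\<close>. Strict
  differentiability transfers the expansion to differences of nearby orbits, so the points whose whole
  orbit stays close to \<open>(x, 0)\<close> form a null set \<open>N\<close>. By the Lindeloef property countably many such neighbourhoods
  suffice, and every point attracted by a saddle lies in some \<open>(T ^^ m)\<close>-preimage of some \<open>N\<close>.

  The function value of the smoothed objective decreases along orbits, which keeps them in the level
  set. There the condition \<open>\<alpha> < 1 / (1 + L_S)\<close> makes the derivative of \<open>T\<close> injective, so that preimages of
  null sets are null. The only exceptions are orbits along which \<open>x\<close> never moves, and for these \<open>T ^^ m\<close> is
  linear and injective.
\<close>

section \<open>Strict derivatives\<close>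

text \<open>The constants \<open>L\<close>, \<open>\<rho>\<close>, \<open>L_S\<close> and the level
  set belong to one starting point, and \<open>P\<close> is an arbitrary set. So no common domain is
  at hand on which the iteration is a diffeomorphism, as a stable manifold argument would want.
  Everything is arranged pointwise: preimages pass only through points where the derivative is
  injective, and the cover is built from saddles singled out by a Hessian bound alone, whatever the
  level set.

  A quadratic form replaces the spectral splitting. On the nonzero coordinates the linearization has
  multipliers 1 - \<alpha> s, with s the eigenvalues of the scaled Hessian; flat directions have
  multiplier exactly 1. A rate slightly above 1, below some unstable multiplier and equal to none,
  puts every slower direction into the negative part of the form. Avoiding the multipliers yields
  the gain \<delta> |h|^2, and this gain absorbs the errors made in passing from the derivative to
  the map, which are small multiples of |h|^2. Ordinary differentiability would not do, since two
  orbits are compared and neither need sit at the saddle.\<close>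

definition has_strict_derivative ::
    "('a::real_normed_vector \<Rightarrow> 'b::real_normed_vector) \<Rightarrow> ('a \<Rightarrow> 'b) \<Rightarrow> 'a \<Rightarrow> bool" where
  "has_strict_derivative f A x \<longleftrightarrow> bounded_linear A \<and>
     (\<forall>e>0. \<forall>\<^sub>F p in nhds (x, x).
        norm (f (fst p) - f (snd p) - A (fst p - snd p)) \<le> e * norm (fst p - snd p))"

lemma strict_derivativeI:
  assumes "bounded_linear A"
    and "\<And>e. e > 0 \<Longrightarrow> \<forall>\<^sub>F p in nhds (x, x).
        norm (f (fst p) - f (snd p) - A (fst p - snd p)) \<le> e * norm (fst p - snd p)"
  shows "has_strict_derivative f A x"
  using assms by (auto simp: has_strict_derivative_def)

lemma strict_derivativeD:
  assumes "has_strict_derivative f A x"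
  shows "bounded_linear A"
    and "e > 0 \<Longrightarrow> \<forall>\<^sub>F p in nhds (x, x).
        norm (f (fst p) - f (snd p) - A (fst p - snd p)) \<le> e * norm (fst p - snd p)"
  using assms by (auto simp: has_strict_derivative_def)

lemma eventually_nhds_diagI:
  assumes "\<forall>\<^sub>F y in nhds x. P y" and "\<And>y z. P y \<Longrightarrow> P z \<Longrightarrow> Q y z"
  shows "\<forall>\<^sub>F p in nhds (x, x). Q (fst p) (snd p)"
proof -
  have "\<forall>\<^sub>F p in nhds x \<times>\<^sub>F nhds x. P (fst p) \<and> P (snd p)"
    using assms(1) unfolding eventually_prod_filter by (intro exI[of _ P]) auto
  then show ?thesis
    unfolding nhds_prod by (rule eventually_mono) (use assms(2) in auto)
qed

lemma eventually_nhds_diag_ball: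
  fixes x :: "'a::metric_space"
  shows "(\<forall>\<^sub>F p in nhds (x, x). Q (fst p) (snd p)) \<longleftrightarrow>
         (\<exists>d>0. \<forall>y\<in>ball x d. \<forall>z\<in>ball x d. Q y z)"
proof
  assume "\<forall>\<^sub>F p in nhds (x, x). Q (fst p) (snd p)"
  then obtain P1 P2 where P: "eventually P1 (nhds x)" "eventually P2 (nhds x)"
      "\<And>y z. P1 y \<Longrightarrow> P2 z \<Longrightarrow> Q y z"
    unfolding nhds_prod eventually_prod_filter by auto
  then have "\<forall>\<^sub>F y in nhds x. P1 y \<and> P2 y" by (simp add: eventually_conj)
  then obtain d where d: "d > 0" "\<And>y. dist y x < d \<Longrightarrow> P1 y \<and> P2 y"
    unfolding eventually_nhds_metric by blast
  then show "\<exists>d>0. \<forall>y\<in>ball x d. \<forall>z\<in>ball x d. Q y z"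
    using P(3) by (intro exI[of _ d]) (auto simp: dist_commute)
next
  assume "\<exists>d>0. \<forall>y\<in>ball x d. \<forall>z\<in>ball x d. Q y z"
  then obtain d where d: "d > 0" "\<And>y z. y \<in> ball x d \<Longrightarrow> z \<in> ball x d \<Longrightarrow> Q y z" by blast
  have "\<forall>\<^sub>F y in nhds x. y \<in> ball x d"
    using d(1) by (intro eventually_nhds_in_open) auto
  then show "\<forall>\<^sub>F p in nhds (x, x). Q (fst p) (snd p)"
    by (rule eventually_nhds_diagI[where P = "\<lambda>y. y \<in> ball x d" and Q = Q]) (rule d(2))
qed

lemma strict_derivative_ball:
  assumes "has_strict_derivative f A x" "e > 0"
  obtains d where "d > 0" "\<And>y z. y \<in> ball x d \<Longrightarrow> z \<in> ball x d \<Longrightarrow>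
      norm (f y - f z - A (y - z)) \<le> e * norm (y - z)"
proof -
  have "\<exists>d>0. \<forall>y\<in>ball x d. \<forall>z\<in>ball x d. norm (f y - f z - A (y - z)) \<le> e * norm (y - z)"
    using strict_derivativeD(2)[OF assms]
    by (subst (asm) eventually_nhds_diag_ball
          [where Q = "\<lambda>y z. norm (f y - f z - A (y - z)) \<le> e * norm (y - z)"])
  then show ?thesis using that by blast
qed

lemma strict_derivative_lipschitz:
  assumes "has_strict_derivative f A x"
  obtains B where "B > 0"
    "\<forall>\<^sub>F p in nhds (x, x). norm (f (fst p) - f (snd p)) \<le> B * norm (fst p - snd p)"
proof -
  interpret A: bounded_linear A using strict_derivativeD(1)[OF assms] .
  obtain K where K: "K > 0" "\<And>h. norm (A h) \<le> norm h * K" using A.pos_bounded by blast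
  have "\<forall>\<^sub>F p in nhds (x, x). norm (f (fst p) - f (snd p)) \<le> (1 + K) * norm (fst p - snd p)"
    using strict_derivativeD(2)[OF assms zero_less_one]
  proof eventually_elim
    case (elim p)
    have "norm (f (fst p) - f (snd p)) \<le>
        norm (f (fst p) - f (snd p) - A (fst p - snd p)) + norm (A (fst p - snd p))"
      by (metis diff_add_cancel norm_triangle_ineq)
    with elim K(2)[of "fst p - snd p"] show ?case by (simp add: algebra_simps)
  qed
  then show ?thesis using K(1) that[of "1 + K"] by auto
qed

lemma strict_derivative_imp_derivative:
  assumes "has_strict_derivative f A x"
  shows "(f has_derivative A) (at x)"
  unfolding has_derivative_at_alt
proof (intro conjI allI impI)
  show "bounded_linear A" using strict_derivativeD(1)[OF assms] .
  fix e :: real assume "e > 0"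
  from strict_derivative_ball[OF assms this] obtain d where "d > 0" and
    d: "\<And>y z. y \<in> ball x d \<Longrightarrow> z \<in> ball x d \<Longrightarrow> norm (f y - f z - A (y - z)) \<le> e * norm (y - z)"
    by blast
  show "\<exists>d>0. \<forall>y. norm (y - x) < d \<longrightarrow> norm (f y - f x - A (y - x)) \<le> e * norm (y - x)"
    using \<open>d > 0\<close> d[of _ x] by (intro exI[of _ d]) (auto simp: dist_norm norm_minus_commute)
qed

lemma strict_derivative_isCont:
  assumes "has_strict_derivative f A x"
  shows "isCont f x"
  using has_derivative_continuous[OF strict_derivative_imp_derivative[OF assms]] .

section \<open>Calculus rules for strict derivatives\<close>

lemma strict_derivative_linear:
  assumes "bounded_linear A"
  shows "has_strict_derivative A A x"
  by (rule strict_derivativeI[OF assms])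
     (simp add: linear_diff[OF bounded_linear.linear[OF assms]])

lemma strict_derivative_compose:
  assumes f: "has_strict_derivative f A x" and g: "has_strict_derivative g B (f x)"
  shows "has_strict_derivative (\<lambda>y. g (f y)) (\<lambda>h. B (A h)) x"
proof (rule strict_derivativeI)
  interpret B: bounded_linear B using strict_derivativeD(1)[OF g] .
  show "bounded_linear (\<lambda>h. B (A h))"
    using strict_derivativeD(1)[OF f] B.bounded_linear_axioms by (rule bounded_linear_compose[rotated])
  fix e :: real assume e: "e > 0"
  obtain L where L: "L > 0"
      "\<forall>\<^sub>F p in nhds (x, x). norm (f (fst p) - f (snd p)) \<le> L * norm (fst p - snd p)"
    using strict_derivative_lipschitz[OF f] by blast
  obtain K where K: "K > 0" "\<And>h. norm (B h) \<le> norm h * K" using B.pos_bounded by blast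
  have lim: "((\<lambda>p. (f (fst p), f (snd p))) \<longlongrightarrow> (f x, f x)) (nhds (x, x))"
  proof -
    have c: "filterlim f (nhds (f x)) (nhds x)"
      using strict_derivative_isCont[OF f] by (simp add: isCont_def tendsto_at_iff_tendsto_nhds)
    have "filterlim fst (nhds x) (nhds (x, x))" "filterlim snd (nhds x) (nhds (x, x))"
      unfolding nhds_prod by (rule filterlim_fst filterlim_snd)+
    with c show ?thesis
      by (intro tendsto_Pair) (auto intro: filterlim_compose)
  qed
  have "\<forall>\<^sub>F q in nhds (f x, f x). norm (g (fst q) - g (snd q) - B (fst q - snd q))
      \<le> e / (2 * L) * norm (fst q - snd q)"
    using e L(1) by (intro strict_derivativeD(2)[OF g]) auto
  from eventually_compose_filterlim[OF this lim]
  have "\<forall>\<^sub>F p in nhds (x, x). norm (g (f (fst p)) - g (f (snd p)) - B (f (fst p) - f (snd p)))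
      \<le> e / (2 * L) * norm (f (fst p) - f (snd p))"
    by simp
  moreover have "\<forall>\<^sub>F p in nhds (x, x). norm (f (fst p) - f (snd p) - A (fst p - snd p))
      \<le> e / (2 * K) * norm (fst p - snd p)"
    using strict_derivativeD(2)[OF f, of "e / (2 * K)"] e K(1) by auto
  ultimately show "\<forall>\<^sub>F p in nhds (x, x). norm (g (f (fst p)) - g (f (snd p)) - B (A (fst p - snd p)))
      \<le> e * norm (fst p - snd p)"
    using L(2)
  proof eventually_elim
    case (elim p)
    let ?y = "fst p" and ?z = "snd p"
    have "norm (g (f ?y) - g (f ?z) - B (A (?y - ?z))) \<le>
       norm (g (f ?y) - g (f ?z) - B (f ?y - f ?z)) + norm (B (f ?y - f ?z - A (?y - ?z)))"
      by (rule order_trans[OF _ norm_triangle_ineq]) (simp add: B.diff)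
    also have "norm (g (f ?y) - g (f ?z) - B (f ?y - f ?z)) \<le> e / (2 * L) * (L * norm (?y - ?z))"
      by (rule order_trans[OF elim(1) mult_left_mono[OF elim(3)]]) (use e L(1) in auto)
    also have "norm (B (f ?y - f ?z - A (?y - ?z))) \<le> (e / (2 * K) * norm (?y - ?z)) * K"
      using K(2)[of "f ?y - f ?z - A (?y - ?z)"] mult_right_mono[OF elim(2), of K] K(1) by simp
    finally show ?case using L(1) K(1) by simp
  qed
qed

lemma strict_derivative_Pair:
  assumes f: "has_strict_derivative f A x" and g: "has_strict_derivative g B x"
  shows "has_strict_derivative (\<lambda>y. (f y, g y)) (\<lambda>h. (A h, B h)) x"
proof (rule strict_derivativeI)
  show "bounded_linear (\<lambda>h. (A h, B h))"
    using strict_derivativeD(1)[OF f] strict_derivativeD(1)[OF g] by (rule bounded_linear_Pair)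
  fix e :: real assume e: "e > 0"
  have *: "norm (a, b) \<le> norm a + norm b" for a :: 'b and b :: 'c
    by (simp add: norm_Pair sqrt_sum_squares_le_sum)
  from strict_derivativeD(2)[OF f, of "e/2"] strict_derivativeD(2)[OF g, of "e/2"]
  have "\<forall>\<^sub>F p in nhds (x, x). norm (f (fst p) - f (snd p) - A (fst p - snd p)) \<le> e/2 * norm (fst p - snd p)"
       "\<forall>\<^sub>F p in nhds (x, x). norm (g (fst p) - g (snd p) - B (fst p - snd p)) \<le> e/2 * norm (fst p - snd p)"
    using e by auto
  then show "\<forall>\<^sub>F p in nhds (x, x). norm ((f (fst p), g (fst p)) - (f (snd p), g (snd p)) -
        (A (fst p - snd p), B (fst p - snd p))) \<le> e * norm (fst p - snd p)"
    by eventually_elim (simp, rule order_trans[OF *], simp)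
qed

lemma strict_derivative_bounded_linear:
  assumes "bounded_linear B" "has_strict_derivative f A x"
  shows "has_strict_derivative (\<lambda>y. B (f y)) (\<lambda>h. B (A h)) x"
  using strict_derivative_compose[OF assms(2) strict_derivative_linear[OF assms(1)]] .

lemma strict_derivative_add:
  assumes f: "has_strict_derivative f A x" and g: "has_strict_derivative g B x"
  shows "has_strict_derivative (\<lambda>y. f y + g y) (\<lambda>h. A h + B h) x"
  using strict_derivative_bounded_linear[OF bounded_linear_add[OF bounded_linear_fst bounded_linear_snd]
      strict_derivative_Pair[OF f g]] by simp

lemma strict_derivative_diff:
  assumes f: "has_strict_derivative f A x" and g: "has_strict_derivative g B x"
  shows "has_strict_derivative (\<lambda>y. f y - g y) (\<lambda>h. A h - B h) x"
  using strict_derivative_bounded_linear[OF bounded_linear_sub[OF bounded_linear_fst bounded_linear_snd]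
      strict_derivative_Pair[OF f g]] by simp

text \<open>The mean value inequality on a small ball, applied to \<open>f\<close> minus its linear
  part \<open>f' x\<close>: the derivative of this difference has norm at most \<open>e\<close>
  there.\<close>

lemma strict_derivative_C1:
  fixes f :: "'a::real_normed_vector \<Rightarrow> 'b::real_normed_vector"
  assumes d: "\<forall>\<^sub>F y in nhds x. (f has_derivative f' y) (at y)"
    and c: "\<And>e. e > 0 \<Longrightarrow> \<forall>\<^sub>F y in nhds x. \<forall>h. norm (f' y h - f' x h) \<le> e * norm h"
  shows "has_strict_derivative f (f' x) x"
proof (rule strict_derivativeI)
  show bl: "bounded_linear (f' x)"
    using eventually_nhds_x_imp_x[OF d] by (rule has_derivative_bounded_linear)
  fix e :: real assume "e > 0"
  from eventually_conj[OF d c[OF this]]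
  have "\<forall>\<^sub>F y in nhds x. (f has_derivative f' y) (at y) \<and> (\<forall>h. norm (f' y h - f' x h) \<le> e * norm h)" .
  then obtain r where r: "r > 0" "\<And>y. dist y x < r \<Longrightarrow>
      (f has_derivative f' y) (at y) \<and> (\<forall>h. norm (f' y h - f' x h) \<le> e * norm h)"
    unfolding eventually_nhds_metric by blast
  have "norm (f y - f z - f' x (y - z)) \<le> e * norm (y - z)" if "y \<in> ball x r" "z \<in> ball x r" for y z
  proof -
    have "norm ((\<lambda>w. f w - f' x w) y - (\<lambda>w. f w - f' x w) z) \<le> e * norm (y - z)"
    proof (rule differentiable_bound[OF convex_ball[of x r], where f = "\<lambda>w. f w - f' x w" and f' = "\<lambda>y h. f' y h - f' x h"])
      fix w assume "w \<in> ball x r"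
      then have w: "(f has_derivative f' w) (at w)" "\<And>h. norm (f' w h - f' x h) \<le> e * norm h"
        using r(2)[of w] by (auto simp: dist_commute)
      show "((\<lambda>w. f w - f' x w) has_derivative (\<lambda>h. f' w h - f' x h)) (at w within ball x r)"
        by (rule has_derivative_at_withinI[OF has_derivative_diff[OF w(1)
              bounded_linear_imp_has_derivative[OF bl]]])
      show "onorm (\<lambda>h. f' w h - f' x h) \<le> e"
        using w(2) by (rule onorm_bound[OF less_imp_le[OF \<open>e > 0\<close>]])
    qed (use that in auto)
    then show ?thesis by (simp add: linear_diff[OF bounded_linear.linear[OF bl]] algebra_simps)
  qed
  then show "\<forall>\<^sub>F p in nhds (x, x). norm (f (fst p) - f (snd p) - f' x (fst p - snd p)) \<le> e * norm (fst p - snd p)"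
    using r(1) eventually_nhds_diag_ball
          [where x = x and Q = "\<lambda>y z. norm (f y - f z - f' x (y - z)) \<le> e * norm (y - z)"] by blast
qed

lemma strict_derivative_real:
  fixes h :: "real \<Rightarrow> real"
  assumes "\<forall>\<^sub>F y in nhds x. (h has_real_derivative h' y) (at y)" and "isCont h' x"
  shows "has_strict_derivative h (\<lambda>t. h' x * t) x"
proof (rule strict_derivative_C1[where f' = "\<lambda>y t. h' y * t"])
  show "\<forall>\<^sub>F y in nhds x. (h has_derivative (*) (h' y)) (at y)"
    using assms(1) by (simp add: has_field_derivative_def)
  fix e :: real assume "e > 0"
  have "filterlim h' (nhds (h' x)) (nhds x)"
    using assms(2) by (simp add: isCont_def tendsto_at_iff_tendsto_nhds)
  then have "\<forall>\<^sub>F y in nhds x. dist (h' y) (h' x) < e"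
    using \<open>e > 0\<close> by (rule tendstoD)
  then show "\<forall>\<^sub>F y in nhds x. \<forall>t. norm (h' y * t - h' x * t) \<le> e * norm t"
    by eventually_elim
       (auto simp: dist_real_def abs_mult simp flip: left_diff_distrib intro!: mult_right_mono)
qed

text \<open>The chain rule, with multiplication seen as a continuously differentiable function of a
  pair of reals.\<close>

lemma strict_derivative_mult:
  fixes f g :: "'a::real_normed_vector \<Rightarrow> real"
  assumes f: "has_strict_derivative f A x" and g: "has_strict_derivative g B x"
  shows "has_strict_derivative (\<lambda>y. f y * g y) (\<lambda>h. f x * B h + A h * g x) x"
proof -
  let ?m = "\<lambda>p :: real \<times> real. fst p * snd p" and ?m' = "\<lambda>p h :: real \<times> real. fst p * snd h + fst h * snd p"
  have "has_strict_derivative ?m (?m' (f x, g x)) (f x, g x)"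
  proof (rule strict_derivative_C1[where f' = ?m'])
    show "\<forall>\<^sub>F y in nhds (f x, g x). (?m has_derivative ?m' y) (at y)"
      by (intro always_eventually allI) (auto intro!: derivative_eq_intros)
    fix e :: real assume "e > 0"
    have "\<forall>\<^sub>F y in nhds (f x, g x). dist y (f x, g x) < e / 2"
      unfolding eventually_nhds_metric using \<open>e > 0\<close> by (intro exI[of _ "e / 2"]) auto
    then show "\<forall>\<^sub>F y in nhds (f x, g x). \<forall>h. norm (?m' y h - ?m' (f x, g x) h) \<le> e * norm h"
    proof eventually_elim
      case (elim y)
      show ?case
      proof
        fix h :: "real \<times> real"
        have "\<bar>fst y - f x\<bar> \<le> e/2" "\<bar>snd y - g x\<bar> \<le> e/2"
          using elim dist_fst_le[of y "(f x, g x)"] dist_snd_le[of y "(f x, g x)"]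
          by (auto simp: dist_real_def)
        moreover have "\<bar>fst h\<bar> \<le> norm h" "\<bar>snd h\<bar> \<le> norm h"
          using norm_fst_le[of "fst h" "snd h"] norm_snd_le[of "snd h" "fst h"] by auto
        ultimately have "\<bar>(fst y - f x) * snd h\<bar> \<le> e/2 * norm h" "\<bar>fst h * (snd y - g x)\<bar> \<le> norm h * (e/2)"
          unfolding abs_mult using \<open>e > 0\<close> by (intro mult_mono; simp)+
        moreover have "norm (?m' y h - ?m' (f x, g x) h) \<le> \<bar>(fst y - f x) * snd h\<bar> + \<bar>fst h * (snd y - g x)\<bar>"
          by (rule order_trans[OF _ abs_triangle_ineq]) (simp add: algebra_simps)
        ultimately show "norm (?m' y h - ?m' (f x, g x) h) \<le> e * norm h"
          by (simp add: algebra_simps)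
      qed
    qed
  qed
  from strict_derivative_compose[OF strict_derivative_Pair[OF f g] this] show ?thesis by simp
qed

lemma strict_derivative_vec:
  fixes f :: "'a::real_normed_vector \<Rightarrow> real ^ 'n::finite"
  assumes "\<And>i. has_strict_derivative (\<lambda>y. f y $ i) (\<lambda>h. A h $ i) x"
  shows "has_strict_derivative f A x"
proof (rule strict_derivativeI)
  have A: "bounded_linear (\<lambda>h. A h $ i)" for i using strict_derivativeD(1)[OF assms] .
  show "bounded_linear A"
    using A by (subst bounded_linear_componentwise_iff) (auto simp: Basis_vec_def inner_axis)
  fix e :: real assume e: "e > 0"
  let ?n = "real CARD('n)"
  have n: "?n > 0" by simp
  have "\<forall>\<^sub>F p in nhds (x, x). \<forall>i\<in>UNIV. norm (f (fst p) $ i - f (snd p) $ i - A (fst p - snd p) $ i)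
      \<le> e / ?n * norm (fst p - snd p)"
    using strict_derivativeD(2)[OF assms, of "e / ?n"] e n by (intro eventually_ball_finite) auto
  then show "\<forall>\<^sub>F p in nhds (x, x). norm (f (fst p) - f (snd p) - A (fst p - snd p)) \<le> e * norm (fst p - snd p)"
  proof eventually_elim
    case (elim p)
    have "norm (f (fst p) - f (snd p) - A (fst p - snd p)) \<le>
        (\<Sum>i\<in>UNIV. \<bar>(f (fst p) - f (snd p) - A (fst p - snd p)) $ i\<bar>)" by (rule norm_le_l1_cart)
    also have "\<dots> \<le> (\<Sum>i\<in>(UNIV::'n set). e / ?n * norm (fst p - snd p))"
      using elim by (intro sum_mono) auto
    finally show ?case using n by simp
  qed
qed

section \<open>Negligible preimages and repelling points\<close>

text \<open>An injective \<open>A\<close> is bounded below by some \<open>m\<close>, and near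
  \<open>q\<close> strict differentiability spoils at most half of this bound. So \<open>T\<close>
  is injective there with a Lipschitz inverse, and Lipschitz images of null sets are null.
  Negligibility is a local property, hence \<open>S\<close> can be any set and the assumption
  concerns single points only.\<close>

lemma negligible_preimage_strict_derivative:
  fixes T :: "'a::euclidean_space \<Rightarrow> 'a"
  assumes N: "negligible N"
    and T: "\<And>q. q \<in> S \<Longrightarrow> T q \<in> N \<Longrightarrow> \<exists>A. has_strict_derivative T A q \<and> inj A"
  shows "negligible {q \<in> S. T q \<in> N}"
  unfolding locally_negligible_alt[of "{q \<in> S. T q \<in> N}"]
proof
  fix q assume q: "q \<in> {q \<in> S. T q \<in> N}"
  then obtain A where A: "has_strict_derivative T A q" "inj A" using T by blast
  have lin: "linear A" using strict_derivativeD(1)[OF A(1)] by (rule bounded_linear.linear)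
  obtain m where m: "m > 0" "\<And>h. m * norm h \<le> norm (A h)"
    using linear_inj_bounded_below_pos[OF lin A(2)] by (metis mult.commute)
  obtain d where d: "d > 0" "\<And>y z. y \<in> ball q d \<Longrightarrow> z \<in> ball q d \<Longrightarrow>
      norm (T y - T z - A (y - z)) \<le> m/2 * norm (y - z)"
    using strict_derivative_ball[OF A(1), of "m/2"] m(1) by auto
  have low: "norm (y - z) \<le> 2/m * norm (T y - T z)" if "y \<in> ball q d" "z \<in> ball q d" for y z
  proof -
    have "norm (A (y - z)) \<le> norm (T y - T z) + norm (T y - T z - A (y - z))"
      by (metis norm_triangle_sub norm_minus_commute add.commute)
    then have "m * norm (y - z) \<le> norm (T y - T z) + m/2 * norm (y - z)"
      using d(2)[OF that] m(2)[of "y - z"] by linarith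
    then show ?thesis using m(1) by (simp add: field_simps)
  qed
  then have inj: "inj_on T (ball q d)"
    by (intro inj_onI) fastforce
  let ?U = "{q \<in> S. T q \<in> N} \<inter> ball q d"
  let ?g = "inv_into (ball q d) T"
  have "negligible (?g ` (T ` ?U))"
  proof (rule negligible_locally_Lipschitz_image)
    show "negligible (T ` ?U)" using N by (rule negligible_subset) auto
    fix x assume x: "x \<in> T ` ?U"
    have "norm (?g y - ?g x) \<le> 2/m * norm (y - x)" if "y \<in> T ` ?U" for y
      using that x low by (auto simp: inv_into_f_f[OF inj])
    then show "\<exists>Ta B. open Ta \<and> x \<in> Ta \<and> (\<forall>y\<in>T ` ?U \<inter> Ta. norm (?g y - ?g x) \<le> B * norm (y - x))"
      by (intro exI[of _ UNIV] exI[of _ "2/m"]) auto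
  qed simp
  moreover have "?g ` (T ` ?U) = ?U"
    using inj by (force simp: image_image inv_into_f_f)
  ultimately have "negligible ?U" by simp
  then show "\<exists>U. openin (top_of_set {q \<in> S. T q \<in> N}) U \<and> q \<in> U \<and> negligible U"
    using q d(1) by (intro exI[of _ ?U]) (auto intro: openin_open_Int)
qed

text \<open>The induction peels off the first step of the orbit. Injectivity is demanded along the
  orbit of \<open>q\<close> and not on a neighbourhood, because it will be known only orbit by
  orbit.\<close>

lemma negligible_preimage_funpow:
  fixes T :: "'a::euclidean_space \<Rightarrow> 'a"
  assumes "negligible N"
  shows "negligible {q. (\<forall>i<m. \<exists>A. has_strict_derivative T A ((T ^^ i) q) \<and> inj A) \<and> (T ^^ m) q \<in> N}"
proof (induction m)
  case 0
  then show ?case using assms by simp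
next
  case (Suc m)
  let ?N = "{q. (\<forall>i<m. \<exists>A. has_strict_derivative T A ((T ^^ i) q) \<and> inj A) \<and> (T ^^ m) q \<in> N}"
  have "negligible {q \<in> {q. \<exists>A. has_strict_derivative T A q \<and> inj A}. T q \<in> ?N}"
    by (rule negligible_preimage_strict_derivative[OF Suc]) auto
  moreover have "{q. (\<forall>i<Suc m. \<exists>A. has_strict_derivative T A ((T ^^ i) q) \<and> inj A) \<and> (T ^^ Suc m) q \<in> N}
      \<subseteq> {q \<in> {q. \<exists>A. has_strict_derivative T A q \<and> inj A}. T q \<in> ?N}"
    by (auto simp: funpow_Suc_right All_less_Suc2 simp del: funpow.simps)
  ultimately show ?case by (rule negligible_subset)
qed

text \<open>The translates \<open>W + v / n\<close> are pairwise disjoint, equal in measure, and lie in one bounded set.\<close>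

lemma negligible_if_disjoint_translates:
  fixes W :: "'a::euclidean_space set"
  assumes W: "compact W" and uniq: "\<And>x s. x \<in> W \<Longrightarrow> x + s *\<^sub>R v \<in> W \<Longrightarrow> s = 0"
  shows "negligible W"
proof -
  obtain R where R: "R > 0" "W \<subseteq> cball 0 R"
    using compact_imp_bounded[OF W] by (fastforce simp: bounded_pos)
  have Wm: "W \<in> lmeasurable" using W by (rule lmeasurable_compact)
  define c where "c n = (1 / real (Suc n)) *\<^sub>R v" for n
  define D where "D n = (+) (c n) ` W" for n
  have Dm: "D n \<in> lmeasurable" for n
    unfolding D_def using Wm by (rule measurable_translation)
  have Dmeas: "measure lebesgue (D n) = measure lebesgue W" for n
    unfolding D_def by (rule measure_translation)
  have disj: "D i \<inter> D j = {}" if "i \<noteq> j" for i j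
  proof -
    show ?thesis
    proof (rule ccontr)
      assume "D i \<inter> D j \<noteq> {}"
      then obtain x y where xy: "x \<in> W" "y \<in> W" "c i + x = c j + y" by (auto simp: D_def)
      then have "y = x + (1 / real (Suc i) - 1 / real (Suc j)) *\<^sub>R v"
        by (simp add: c_def algebra_simps)
      with uniq[OF xy(1)] xy(2) have "1 / real (Suc i) - 1 / real (Suc j) = 0" by blast
      with \<open>i \<noteq> j\<close> show False by simp
    qed
  qed
  let ?B = "cball (0::'a) (R + norm v)"
  have sub: "D n \<subseteq> ?B" for n
  proof
    fix x assume "x \<in> D n"
    then obtain y where y: "y \<in> W" "x = c n + y" by (auto simp: D_def)
    have "norm (c n) \<le> norm v"
      by (simp add: c_def divide_le_eq mult_le_cancel_left1)
    moreover have "norm y \<le> R" using R(2) y(1) by auto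
    ultimately show "x \<in> ?B" using norm_triangle_ineq[of "c n" y] by (simp add: y(2))
  qed
  have bound: "real n * measure lebesgue W \<le> measure lebesgue ?B" for n
  proof -
    have "measure lebesgue (\<Union>i\<in>{..<n}. D i) = (\<Sum>i<n. measure lebesgue (D i))"
      using disj fmeasurableD[OF Dm] fmeasurableD2[OF Dm]
      by (intro measure_finite_Union) (auto simp: disjoint_family_on_def)
    moreover have "measure lebesgue (\<Union>i\<in>{..<n}. D i) \<le> measure lebesgue ?B"
      using sub Dm by (intro measure_mono_fmeasurable) (auto intro!: fmeasurableD lmeasurable_cball)
    ultimately show ?thesis by (simp add: Dmeas)
  qed
  have "measure lebesgue W = 0"
  proof (rule ccontr)
    assume "measure lebesgue W \<noteq> 0"
    then have pos: "measure lebesgue W > 0" by (simp add: zero_less_measure_iff)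
    then obtain n where "measure lebesgue ?B < real n * measure lebesgue W"
      using reals_Archimedean3 by blast
    with bound[of n] show False by simp
  qed
  then show ?thesis using Wm by (simp add: negligible_iff_measure)
qed

text \<open>If two orbits stay near \<open>z\<close> and start at a difference \<open>h\<close> with \<open>b h h > 0\<close>, then \<open>b\<close> evaluated on
  their difference grows geometrically. Hence every line in direction \<open>v\<close> meets the set of trapped
  points at most once; no invariant manifold is needed, and \<open>A\<close> may be singular.\<close>

lemma negligible_trapped_set:
  fixes T :: "'a::euclidean_space \<Rightarrow> 'a" and b :: "'a \<Rightarrow> 'a \<Rightarrow> real"
  assumes T: "has_strict_derivative T A z" and b: "bounded_bilinear b"
    and g: "g > 1" and d: "d > 0"
    and expand: "\<And>h. b (A h) (A h) \<ge> g * b h h + d * (norm h)\<^sup>2"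
    and v: "b v v > 0"
  shows "\<exists>U. open U \<and> z \<in> U \<and> negligible {q. \<forall>k. (T ^^ k) q \<in> U}"
proof -
  interpret b: bounded_bilinear b by fact
  interpret A: bounded_linear A using strict_derivativeD(1)[OF T] .
  obtain K where K: "K > 0" "\<And>x y. norm (b x y) \<le> norm x * norm y * K"
    using b.pos_bounded by blast
  obtain a where a: "a > 0" "\<And>h. norm (A h) \<le> norm h * a" using A.pos_bounded by blast
  \<comment> \<open>The three error terms of \<open>b\<close> below add up to at most
    \<open>\<epsilon> * K * (2 * a + 1)\<close> times |h|^2, which this choice keeps below the gain
    \<open>d\<close>; \<open>\<epsilon> \<le> 1\<close> serves the term quadratic in the
    error.\<close>
  define \<epsilon> where "\<epsilon> = min 1 (d / (K * (2 * a + 1)))"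
  have \<epsilon>: "\<epsilon> > 0" "\<epsilon> \<le> 1" and "\<epsilon> \<le> d / (K * (2 * a + 1))"
    using K(1) a(1) d by (auto simp: \<epsilon>_def)
  then have \<epsilon>d: "\<epsilon> * (K * (2 * a + 1)) \<le> d"
    using K(1) a(1) by (simp add: pos_le_divide_eq)
  obtain r where r: "r > 0" "\<And>y y'. y \<in> ball z r \<Longrightarrow> y' \<in> ball z r \<Longrightarrow>
      norm (T y - T y' - A (y - y')) \<le> \<epsilon> * norm (y - y')"
    using strict_derivative_ball[OF T \<epsilon>(1)] by blast
  \<comment> \<open>A closed ball makes the trapped set compact; half the radius keeps it inside the
    ball where the strict estimate holds.\<close>
  define B where "B = cball z (r/2)"
  have BB: "y \<in> ball z r" if "y \<in> B" for y using that r(1) by (auto simp: B_def)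
  have growth: "b (T y - T y') (T y - T y') \<ge> g * b (y - y') (y - y')" if "y \<in> B" "y' \<in> B" for y y'
  proof -
    define h where "h = y - y'"
    define e where "e = T y - T y' - A h"
    have e: "norm e \<le> \<epsilon> * norm h" using r(2)[OF BB BB, OF that] by (simp add: e_def h_def)
    then have e1: "norm e \<le> norm h"
      using \<epsilon> mult_right_mono[of \<epsilon> 1 "norm h"] by simp
    have 1: "\<bar>b (A h) e\<bar> \<le> norm h * a * (\<epsilon> * norm h) * K"
      by (rule order_trans[OF K(2)[of "A h" e, unfolded real_norm_def]])
         (intro mult_mono a(2) e; use a(1) K(1) \<epsilon>(1) in simp)
    have 2: "\<bar>b e (A h)\<bar> \<le> (\<epsilon> * norm h) * (norm h * a) * K"
      by (rule order_trans[OF K(2)[of e "A h", unfolded real_norm_def]])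
         (intro mult_mono a(2) e; use a(1) K(1) \<epsilon>(1) in simp)
    have 3: "\<bar>b e e\<bar> \<le> (\<epsilon> * norm h) * norm h * K"
      by (rule order_trans[OF K(2)[of e e, unfolded real_norm_def]])
         (intro mult_mono e1 e; use a(1) K(1) \<epsilon>(1) in simp)
    have "norm h * a * (\<epsilon> * norm h) * K + (\<epsilon> * norm h) * (norm h * a) * K + (\<epsilon> * norm h) * norm h * K
        = \<epsilon> * (K * (2 * a + 1)) * (norm h)\<^sup>2"
      by (simp add: algebra_simps power2_eq_square)
    also have "\<dots> \<le> d * (norm h)\<^sup>2" using \<epsilon>d by (intro mult_right_mono) auto
    finally have "b (A h) (A h) + (b (A h) e + b e (A h) + b e e) \<ge> g * b h h"
      using 1 2 3 expand[of h] by linarith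
    moreover have "T y - T y' = A h + e" by (simp add: e_def)
    ultimately show ?thesis by (simp add: b.add_left b.add_right h_def algebra_simps)
  qed
  have contT: "continuous_on B T"
  proof (rule lipschitz_on_continuous_on)
    show "(a + 1)-lipschitz_on B T"
    proof (rule lipschitz_onI)
      fix y y' assume y: "y \<in> B" "y' \<in> B"
      have "norm (T y - T y') \<le> norm (A (y - y')) + norm (T y - T y' - A (y - y'))"
        by (metis norm_triangle_sub)
      moreover have "\<epsilon> * norm (y - y') \<le> norm (y - y')"
        using \<epsilon> mult_right_mono[of \<epsilon> 1 "norm (y - y')"] by simp
      ultimately show "dist (T y) (T y') \<le> (a + 1) * dist y y'"
        using a(2)[of "y - y'"] r(2)[OF BB BB, OF y] by (simp add: dist_norm algebra_simps)
    qed (use a in simp)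
  qed
  define W where "W = {q. \<forall>k. (T ^^ k) q \<in> B}"
  have Bc: "closed B" by (simp add: B_def)
  \<comment> \<open>\<open>T\<close> is known to be continuous on \<open>B\<close> only, so the
    limit orbit is followed step by step, its membership in \<open>B\<close> being secured before
    \<open>T\<close> is applied again.\<close>
  have "closed W"
    unfolding closed_sequential_limits
  proof (intro allI impI, elim conjE)
    fix x l assume x: "\<forall>n. x n \<in> W" and l: "x \<longlonglongrightarrow> l"
    have "(\<lambda>n. (T ^^ k) (x n)) \<longlonglongrightarrow> (T ^^ k) l \<and> (T ^^ k) l \<in> B" for k
    proof (induction k)
      case 0
      have "\<forall>n. (T ^^ 0) (x n) \<in> B" using x unfolding W_def by blast
      then show ?case using l Bc closed_sequentially[of B x l] by auto
    next
      case (Suc k)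
      have xB: "(T ^^ j) (x n) \<in> B" for j n using x unfolding W_def by blast
      have "(\<lambda>n. T ((T ^^ k) (x n))) \<longlonglongrightarrow> T ((T ^^ k) l)"
        using xB Suc by (intro continuous_on_tendsto_compose[OF contT]) auto
      moreover have "T ((T ^^ k) (x n)) \<in> B" for n using xB[of "Suc k" n] by simp
      ultimately show ?case
        using closed_sequentially[OF Bc, of "\<lambda>n. T ((T ^^ k) (x n))"] by simp
    qed
    then show "l \<in> W" by (simp add: W_def)
  qed
  moreover have WB: "W \<subseteq> B"
  proof
    fix q assume "q \<in> W"
    then have "(T ^^ 0) q \<in> B" unfolding W_def by blast
    then show "q \<in> B" by simp
  qed
  ultimately have "compact W"
    using bounded_subset[OF bounded_cball] by (auto simp: compact_eq_bounded_closed B_def)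
  then have "negligible W"
  proof (rule negligible_if_disjoint_translates[where v = v])
    fix x s assume x: "x \<in> W" "x + s *\<^sub>R v \<in> W"
    define h where "h k = (T ^^ k) (x + s *\<^sub>R v) - (T ^^ k) x" for k
    have hB: "(T ^^ k) (x + s *\<^sub>R v) \<in> B" "(T ^^ k) x \<in> B" for k
      using x by (auto simp: W_def)
    have lower: "b (h k) (h k) \<ge> g ^ k * (s\<^sup>2 * b v v)" for k
    proof (induction k)
      case 0
      show ?case by (simp add: h_def b.scaleR_left b.scaleR_right power2_eq_square)
    next
      case (Suc k)
      have "g ^ Suc k * (s\<^sup>2 * b v v) \<le> g * b (h k) (h k)"
        using mult_left_mono[OF Suc, of g] g by (simp add: mult.assoc)
      also have "\<dots> \<le> b (h (Suc k)) (h (Suc k))"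
        using growth[OF hB] by (simp add: h_def)
      finally show ?case .
    qed
    have upper: "b (h k) (h k) \<le> r * r * K" for k
    proof -
      have "norm (h k) \<le> r"
        using hB[of k] dist_triangle2[of "(T ^^ k) (x + s *\<^sub>R v)" "(T ^^ k) x" z]
        by (simp add: h_def B_def dist_norm norm_minus_commute)
      then have "norm (h k) * norm (h k) * K \<le> r * r * K"
        using K(1) r(1) by (intro mult_mono) auto
      then show ?thesis using K(2)[of "h k" "h k"] by auto
    qed
    show "s = 0"
    proof (rule ccontr)
      assume "s \<noteq> 0"
      then have c: "s\<^sup>2 * b v v > 0" using v by simp
      obtain k where "r * r * K / (s\<^sup>2 * b v v) < g ^ k" using real_arch_pow[OF g] by blast
      then have "r * r * K < g ^ k * (s\<^sup>2 * b v v)" using c by (simp add: pos_divide_less_eq)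
      with lower[of k] upper[of k] show False by simp
    qed
  qed
  then have "negligible {q. \<forall>k. (T ^^ k) q \<in> ball z (r/2)}"
    by (rule negligible_subset) (auto simp: W_def B_def less_imp_le)
  then show ?thesis using r(1) by (intro exI[of _ "ball z (r/2)"]) auto
qed

section \<open>The iteration map and its strict derivatives\<close>

text \<open>A crude constant suffices: the bound only turns continuity of the Hessian entries into
  continuity in operator norm.\<close>

lemma norm_matrix_vector_mult_le:
  fixes A :: "real ^ 'n::finite ^ 'm::finite"
  shows "norm (A *v h) \<le> real CARD('m) * real CARD('n) * norm A * norm h"
proof -
  have "onorm ((*v) A) \<le> real CARD('m) * real CARD('n) * norm A"
    by (rule onorm_le_matrix_component)
       (meson Finite_Cartesian_Product.norm_nth_le order_trans real_norm_def component_le_norm_cart)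
  then have "onorm ((*v) A) * norm h \<le> real CARD('m) * real CARD('n) * norm A * norm h"
    by (rule mult_right_mono) simp
  with onorm[OF matrix_vector_mul_bounded_linear[of A], of h] show ?thesis by linarith
qed

text \<open>\<open>partial\<close> rests on \<open>deriv\<close>, which is meaningful only where a
  derivative exists. Restricting the Frechet derivative to the coordinate lines identifies the
  two.\<close>

lemma has_derivative_gradient:
  assumes "f differentiable (at x)"
  shows "(f has_derivative (\<lambda>h. gradient f x \<bullet> h)) (at x)"
proof -
  obtain f' where f': "(f has_derivative f') (at x)" using assms by (auto simp: differentiable_def)
  have lin: "linear f'" using f' by (rule has_derivative_linear)
  have p: "partial i f x = f' (axis i 1)" for i
  proof -
    have "((\<lambda>t::real. x + t *\<^sub>R axis i 1) has_derivative (\<lambda>t. t *\<^sub>R axis i 1)) (at 0)"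
      by (auto intro!: derivative_eq_intros)
    moreover have "(f has_derivative f') (at ((\<lambda>t::real. x + t *\<^sub>R axis i 1) 0))" using f' by simp
    ultimately have "((\<lambda>t. f (x + t *\<^sub>R axis i 1)) has_derivative (\<lambda>t. f' (t *\<^sub>R axis i 1))) (at 0)"
      by (rule has_derivative_compose)
    then have "((\<lambda>t. f (x + t *\<^sub>R axis i 1)) has_real_derivative f' (axis i 1)) (at 0)"
      by (simp add: has_field_derivative_def linear_cmul[OF lin] mult_commute_abs)
    then show ?thesis unfolding partial_def by (rule DERIV_imp_deriv)
  qed
  have "f' h = gradient f x \<bullet> h" for h
  proof -
    have "f' h = f' (\<Sum>i\<in>UNIV. h $ i *\<^sub>R axis i 1)"
      using basis_expansion[of h] by (simp add: scalar_mult_eq_scaleR)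
    also have "\<dots> = (\<Sum>i\<in>UNIV. h $ i * f' (axis i 1))"
      by (simp add: linear_sum[OF lin] linear_cmul[OF lin])
    also have "\<dots> = gradient f x \<bullet> h"
      by (simp add: inner_vec_def gradient_def p mult.commute)
    finally show ?thesis .
  qed
  with f' show ?thesis by (metis (no_types, lifting) ext)
qed

text \<open>The Hessian \<open>H\<close> is a parameter, since \<open>twice_cont_diff\<close> merely
  asserts its existence. Nothing in the locale refers to a starting point.\<close>

locale dirl2_setting =
  fixes f :: "real ^ 'n::finite \<Rightarrow> real" and r :: "real \<Rightarrow> real" and lam \<alpha> \<beta> \<mu> :: real
    and H :: "real ^ 'n \<Rightarrow> real ^ 'n ^ 'n"
  assumes f_diff: "\<And>x. f differentiable (at x)"
    and grad_deriv: "\<And>x. (gradient f has_derivative (\<lambda>h. H x *v h)) (at x)"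
    and H_cont: "continuous_on UNIV H"
    and lam: "lam > 0" and A1: "A1 r" and A4: "A4 r"
    and alpha: "0 < \<alpha>" "\<alpha> < 1" and mu: "0 < \<mu>" "\<mu> < 1" and beta: "\<beta> > 0"
begin

abbreviation "g \<equiv> gradient f"

abbreviation "c \<equiv> 1 - \<alpha> * (1 - \<mu>)"

lemma c_bounds: "0 < c" "c < 1"
proof -
  have "\<alpha> * (1 - \<mu>) \<le> \<alpha> * 1" using alpha mu by (intro mult_left_mono) auto
  then show "0 < c" using alpha by linarith
  show "c < 1" using alpha mu by simp
qed

lemma f_derivative: "(f has_derivative (\<lambda>h. g x \<bullet> h)) (at x)"
  using has_derivative_gradient[OF f_diff] .

lemma gradient_strict: "has_strict_derivative g (\<lambda>h. H x *v h) x"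
proof (rule strict_derivative_C1[where f' = "\<lambda>x h. H x *v h"])
  show "\<forall>\<^sub>F y in nhds x. (g has_derivative (*v) (H y)) (at y)"
    using grad_deriv by simp
  fix e :: real assume e: "e > 0"
  let ?n = "real CARD('n) * real CARD('n)"
  have n: "?n > 0" by simp
  have "filterlim H (nhds (H x)) (nhds x)"
    using H_cont by (simp add: continuous_on_eq_continuous_at isCont_def tendsto_at_iff_tendsto_nhds)
  then have "\<forall>\<^sub>F y in nhds x. dist (H y) (H x) < e / ?n"
    using e n by (intro tendstoD) auto
  then show "\<forall>\<^sub>F y in nhds x. \<forall>h. norm (H y *v h - H x *v h) \<le> e * norm h"
  proof (eventually_elim, intro allI)
    fix y and h :: "real ^ 'n" assume "dist (H y) (H x) < e / ?n"
    then have "?n * norm (H y - H x) \<le> e" using n by (simp add: dist_norm field_simps)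
    then have "?n * norm (H y - H x) * norm h \<le> e * norm h" by (rule mult_right_mono) simp
    with norm_matrix_vector_mult_le[of "H y - H x" h]
    show "norm (H y *v h - H x *v h) \<le> e * norm h"
      by (simp add: matrix_vector_mult_diff_rdistrib)
  qed
qed

section \<open>Symmetry of second derivatives\<close>

text \<open>The mean value theorem in direction \<open>u\<close>, applied to the increment of
  \<open>f\<close> in direction \<open>v\<close>, reduces the second difference to one increment of
  the gradient. Neither endpoint of that increment is \<open>x\<close>, which is why the strict
  estimate is required.\<close>

lemma second_difference_bound:
  assumes d: "\<And>y z. y \<in> ball x d \<Longrightarrow> z \<in> ball x d \<Longrightarrow>
      norm (g y - g z - H x *v (y - z)) \<le> e * norm (y - z)"
    and s: "s > 0" "s * (norm u + norm v) < d"
  shows "\<bar>f (x + s *\<^sub>R u + s *\<^sub>R v) - f (x + s *\<^sub>R u) - f (x + s *\<^sub>R v) + f x - s\<^sup>2 * ((H x *v v) \<bullet> u)\<bar>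
    \<le> s\<^sup>2 * (e * norm u * norm v)"
proof -
  define \<phi> where "\<phi> t = f (x + s *\<^sub>R v + t *\<^sub>R u) - f (x + t *\<^sub>R u)" for t
  have "(\<phi> has_real_derivative ((g (x + s *\<^sub>R v + t *\<^sub>R u) - g (x + t *\<^sub>R u)) \<bullet> u)) (at t)" for t
  proof -
    have *: "((\<lambda>t. f (w + t *\<^sub>R u)) has_derivative (\<lambda>k. g (w + t *\<^sub>R u) \<bullet> (k *\<^sub>R u))) (at t)" for w
      by (rule has_derivative_compose[OF _ f_derivative]) (auto intro!: derivative_eq_intros)
    show ?thesis
      unfolding has_field_derivative_def \<phi>_def
      by (rule has_derivative_eq_rhs[OF has_derivative_diff[OF * *]])
         (auto simp: algebra_simps inner_diff_left)
  qed
  then obtain \<theta> where \<theta>: "0 < \<theta>" "\<theta> < s"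
    "\<phi> s - \<phi> 0 = (s - 0) * ((g (x + s *\<^sub>R v + \<theta> *\<^sub>R u) - g (x + \<theta> *\<^sub>R u)) \<bullet> u)"
    using MVT2[OF s(1), of \<phi> "\<lambda>t. (g (x + s *\<^sub>R v + t *\<^sub>R u) - g (x + t *\<^sub>R u)) \<bullet> u"] by blast
  have b1: "norm (\<theta> *\<^sub>R u) \<le> s * norm u" using \<theta> by (simp add: mult_right_mono)
  have "s * norm u + s * norm v < d" using s(2) by (simp add: algebra_simps)
  moreover have "norm (s *\<^sub>R v + \<theta> *\<^sub>R u) \<le> s * norm v + s * norm u"
    using norm_triangle_ineq[of "s *\<^sub>R v" "\<theta> *\<^sub>R u"] b1 s(1) by simp
  moreover have "0 \<le> s * norm v" using s(1) by simp
  ultimately have "norm (s *\<^sub>R v + \<theta> *\<^sub>R u) < d" "norm (\<theta> *\<^sub>R u) < d"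
    using b1 by linarith+
  moreover have "dist x (x + h) = norm h" for h by (simp add: dist_norm)
  ultimately have "x + s *\<^sub>R v + \<theta> *\<^sub>R u \<in> ball x d" "x + \<theta> *\<^sub>R u \<in> ball x d"
    by (simp_all only: mem_ball add.assoc)
  from d[OF this] have A: "norm (g (x + s *\<^sub>R v + \<theta> *\<^sub>R u) - g (x + \<theta> *\<^sub>R u) - s *\<^sub>R (H x *v v)) \<le> e * (s * norm v)"
    using s(1) by (simp add: matrix_vector_mult_scaleR)
  have "f (x + s *\<^sub>R u + s *\<^sub>R v) - f (x + s *\<^sub>R u) - f (x + s *\<^sub>R v) + f x = \<phi> s - \<phi> 0"
    by (simp add: \<phi>_def algebra_simps)
  then have "f (x + s *\<^sub>R u + s *\<^sub>R v) - f (x + s *\<^sub>R u) - f (x + s *\<^sub>R v) + f x - s\<^sup>2 * ((H x *v v) \<bullet> u)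
     = s * ((g (x + s *\<^sub>R v + \<theta> *\<^sub>R u) - g (x + \<theta> *\<^sub>R u) - s *\<^sub>R (H x *v v)) \<bullet> u)"
    by (simp add: \<theta>(3) inner_diff_left algebra_simps power2_eq_square)
  also have "\<bar>\<dots>\<bar> \<le> s * (norm (g (x + s *\<^sub>R v + \<theta> *\<^sub>R u) - g (x + \<theta> *\<^sub>R u) - s *\<^sub>R (H x *v v)) * norm u)"
    using s(1) Cauchy_Schwarz_ineq2 by (simp add: abs_mult)
  also have "\<dots> \<le> s * (e * (s * norm v) * norm u)"
    using A s(1) by (intro mult_left_mono mult_right_mono) auto
  finally show ?thesis by (simp add: algebra_simps power2_eq_square)
qed

text \<open>Schwarz's theorem: the second difference does not change when \<open>u\<close> and
  \<open>v\<close> are exchanged, and both bilinear expressions approximate it up to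
  \<open>s\<^sup>2\<close> times a small constant.\<close>

lemma H_symmetric: "(H x *v u) \<bullet> v = (H x *v v) \<bullet> u"
proof -
  have "\<bar>(H x *v v) \<bullet> u - (H x *v u) \<bullet> v\<bar> \<le> 0 + e" if e: "e > 0" for e
  proof -
    let ?k = "2 * norm u * norm v + 1"
    have k: "?k > 0" by (simp add: add_nonneg_pos)
    obtain d where d: "d > 0" "\<And>y z. y \<in> ball x d \<Longrightarrow> z \<in> ball x d \<Longrightarrow>
        norm (g y - g z - H x *v (y - z)) \<le> (e / ?k) * norm (y - z)"
      using strict_derivative_ball[OF gradient_strict, of "e / ?k" x] e k by auto
    define s where "s = d / (norm u + norm v + 1)"
    have n: "norm u + norm v + 1 > 0" by (simp add: add_nonneg_pos)
    then have s: "s > 0" using d(1) by (simp add: s_def)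
    have "s * (norm u + norm v + 1) = d" using n by (simp add: s_def)
    then have s2: "s * (norm u + norm v) < d" "s * (norm v + norm u) < d"
      using s by (simp_all add: algebra_simps)
    let ?\<Delta> = "f (x + s *\<^sub>R u + s *\<^sub>R v) - f (x + s *\<^sub>R u) - f (x + s *\<^sub>R v) + f x"
    have 1: "\<bar>?\<Delta> - s\<^sup>2 * ((H x *v v) \<bullet> u)\<bar> \<le> s\<^sup>2 * (e / ?k * norm u * norm v)"
      using d(2) s s2(1) by (rule second_difference_bound)
    have "f (x + s *\<^sub>R v + s *\<^sub>R u) - f (x + s *\<^sub>R v) - f (x + s *\<^sub>R u) + f x = ?\<Delta>"
      by (simp add: algebra_simps)
    with second_difference_bound[OF d(2) s s2(2)]
    have 2: "\<bar>?\<Delta> - s\<^sup>2 * ((H x *v u) \<bullet> v)\<bar> \<le> s\<^sup>2 * (e / ?k * norm v * norm u)" by simp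
    have "s\<^sup>2 * \<bar>(H x *v v) \<bullet> u - (H x *v u) \<bullet> v\<bar> = \<bar>s\<^sup>2 * ((H x *v v) \<bullet> u) - s\<^sup>2 * ((H x *v u) \<bullet> v)\<bar>"
      by (simp add: abs_mult flip: right_diff_distrib)
    also have "\<dots> \<le> s\<^sup>2 * (e / ?k * norm u * norm v) + s\<^sup>2 * (e / ?k * norm v * norm u)"
      using 1 2 by linarith
    also have "\<dots> = s\<^sup>2 * (e / ?k * (2 * norm u * norm v))" by (simp add: algebra_simps)
    finally have "s\<^sup>2 * \<bar>(H x *v v) \<bullet> u - (H x *v u) \<bullet> v\<bar> \<le> s\<^sup>2 * (e / ?k * (2 * norm u * norm v))" .
    then have "\<bar>(H x *v v) \<bullet> u - (H x *v u) \<bullet> v\<bar> \<le> e / ?k * (2 * norm u * norm v)"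
      by (rule mult_left_le_imp_le) (use s in simp)
    also have "\<dots> \<le> e / ?k * ?k" using e k by (intro mult_left_mono) auto
    finally show ?thesis using k by simp
  qed
  then have "\<bar>(H x *v v) \<bullet> u - (H x *v u) \<bullet> v\<bar> \<le> 0" by (rule field_le_epsilon)
  then show ?thesis by simp
qed

section \<open>The scalar reweighting factor and its behaviour at the kink\<close>

lemma r_deriv: "t > 0 \<Longrightarrow> (r has_real_derivative deriv r t) (at t)"
  using A1 by (simp add: A1_def DERIV_deriv_iff_real_differentiable)

lemma r_deriv2: "t > 0 \<Longrightarrow> (deriv r has_real_derivative deriv (deriv r) t) (at t)"
  using A1 by (simp add: A1_def DERIV_deriv_iff_real_differentiable)

lemma r_deriv2_cont: "t > 0 \<Longrightarrow> isCont (deriv (deriv r)) t"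
  using A1 by (auto simp: A1_def continuous_on_eq_continuous_at)

lemma r_deriv_nonneg: "t > 0 \<Longrightarrow> deriv r t \<ge> 0"
  using A1 by (simp add: A1_def)

lemma r_mono: "0 \<le> s \<Longrightarrow> s \<le> t \<Longrightarrow> r s \<le> r t"
proof (rule DERIV_nonneg_imp_increasing_open[where f = r])
  assume "0 \<le> s" "s \<le> t"
  show "continuous_on {s..t} r"
    using A1 \<open>0 \<le> s\<close> by (auto simp: A1_def intro: continuous_on_subset)
qed (auto intro!: r_deriv r_deriv_nonneg exI)

text \<open>The factor inverse(1 + 2 lam u / \<beta>) as a function of the radius t, with the
  division by t cleared. This gives \<open>w 0 = 0\<close> whatever the unspecified value
  \<open>deriv r 0\<close> is.\<close>

definition w :: "real \<Rightarrow> real" where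
  "w t = t / (t + lam / \<beta> * deriv r t)"

definition w' :: "real \<Rightarrow> real" where
  "w' t = lam / \<beta> * (deriv r t - t * deriv (deriv r) t) / (t + lam / \<beta> * deriv r t)\<^sup>2"

lemma w_denom_pos: "t > 0 \<Longrightarrow> t + lam / \<beta> * deriv r t > 0"
  using r_deriv_nonneg lam beta by (simp add: add_pos_nonneg)

lemma w_nonneg: "t \<ge> 0 \<Longrightarrow> 0 \<le> w t"
  using w_denom_pos[of t] by (cases "t = 0") (auto simp: w_def)

lemma w_deriv:
  assumes "t > 0"
  shows "(w has_real_derivative w' t) (at t)"
proof -
  let ?d = "t + lam / \<beta> * deriv r t"
  have d: "((\<lambda>t. t + lam / \<beta> * deriv r t) has_real_derivative (1 + lam / \<beta> * deriv (deriv r) t)) (at t)"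
    by (intro DERIV_add DERIV_ident DERIV_cmult r_deriv2 assms)
  have "?d \<noteq> 0" using w_denom_pos[OF assms] by simp
  from DERIV_divide[OF DERIV_ident d this]
  have "(w has_real_derivative ((1 * ?d - t * (1 + lam / \<beta> * deriv (deriv r) t)) / (?d * ?d))) (at t)"
    by (simp add: w_def [abs_def])
  moreover have "1 * ?d - t * (1 + lam / \<beta> * deriv (deriv r) t) = lam / \<beta> * (deriv r t - t * deriv (deriv r) t)"
    by (simp add: algebra_simps)
  ultimately show ?thesis by (simp only: w'_def power2_eq_square)
qed

lemma w'_cont: "t > 0 \<Longrightarrow> isCont w' t"
  unfolding w'_def [abs_def] using w_denom_pos[of t]
  by (intro continuous_intros r_deriv2_cont DERIV_isCont[OF r_deriv2]) auto

lemma r_deriv_large: "\<forall>\<^sub>F t in at_right 0. deriv r t \<ge> K"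
  using A4 by (auto simp: A4_def filterlim_at_top)

text \<open>Here (A4) enters: \<open>w'\<close> is bounded by a multiple of \<open>1 / r' + \<bar>t r'' / r'\<^sup>2\<bar>\<close>, so it tends to \<open>0\<close> at
  the kink, and the map is strictly differentiable even at points with vanishing coordinates.\<close>

lemma w_lipschitz_near_0:
  assumes e: "e > 0"
  shows "\<exists>d>0. \<forall>s\<in>{0..<d}. \<forall>t\<in>{0..<d}. \<bar>w s - w t\<bar> \<le> e * \<bar>s - t\<bar>"
proof -
  define a where "a = lam / \<beta>"
  have a: "a > 0" using lam beta by (simp add: a_def)
  have "\<forall>\<^sub>F t in at_right 0. dist (t * deriv (deriv r) t / (deriv r t)\<^sup>2) 0 < a * e / 2"
    using A4 a e unfolding A4_def by (intro tendstoD) auto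
  with r_deriv_large[of "2 / (a * e)"]
  have "\<forall>\<^sub>F t in at_right 0. deriv r t \<ge> 2 / (a * e) \<and>
      \<bar>t * deriv (deriv r) t / (deriv r t)\<^sup>2\<bar> < a * e / 2"
    by eventually_elim (auto simp: dist_real_def)
  then obtain d where d: "d > 0" "\<And>t. 0 < t \<Longrightarrow> t < d \<Longrightarrow> deriv r t \<ge> 2 / (a * e) \<and>
      \<bar>t * deriv (deriv r) t / (deriv r t)\<^sup>2\<bar> < a * e / 2"
    unfolding eventually_at_right_field by auto
  \<comment> \<open>Dropping t from the denominator leaves two terms; the lower bound on
    \<open>deriv r t\<close> and the quotient of (A4) make each of them at most
    \<open>e / 2\<close>.\<close>
  have w'b: "\<bar>w' t\<bar> \<le> e" if t: "0 < t" "t < d" for t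
  proof -
    let ?p = "deriv r t" and ?q = "deriv (deriv r) t"
    have "0 < 2 / (a * e)" using a e by simp
    then have p: "?p > 0" "?p \<ge> 2 / (a * e)" using d(2)[OF t] by linarith+
    have "\<bar>w' t\<bar> = a * \<bar>?p - t * ?q\<bar> / (t + a * ?p)\<^sup>2"
      using lam beta by (simp add: w'_def a_def abs_mult)
    also have "\<dots> \<le> a * \<bar>?p - t * ?q\<bar> / (a * ?p)\<^sup>2"
      using a p t by (intro divide_left_mono power_mono mult_pos_pos zero_less_power) (auto intro!: add_nonneg_pos mult_nonneg_nonneg)
    also have "\<dots> \<le> a * (?p + \<bar>t * ?q\<bar>) / (a * ?p)\<^sup>2"
      using a p by (intro divide_right_mono mult_left_mono) auto
    also have "\<dots> = 1 / (a * ?p) + \<bar>t * ?q / ?p\<^sup>2\<bar> / a"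
    proof -
      have "a * (u + X) / (a * u)\<^sup>2 = 1 / (a * u) + (X / u\<^sup>2) / a" if "u > 0" for u X :: real
        using a that by (simp add: field_simps power2_eq_square)
      from this[OF p(1)] show ?thesis by (simp add: abs_divide)
    qed
    also have "\<dots> \<le> e / 2 + (a * e / 2) / a"
    proof (rule add_mono)
      show "1 / (a * ?p) \<le> e / 2" using a e p by (simp add: field_simps)
      show "\<bar>t * ?q / ?p\<^sup>2\<bar> / a \<le> (a * e / 2) / a"
        using d(2)[OF t] a by (intro divide_right_mono) auto
    qed
    also have "\<dots> = e" using a by simp
    finally show ?thesis .
  qed
  \<comment> \<open>The mean value theorem is used only on intervals away from 0. For an interval
    starting at 0 the quotient \<open>w t / t\<close> is 1 / (t + a r'(t)), which is small because
    r' is large.\<close>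
  have w0: "w t \<le> e * t" if t: "0 < t" "t < d" for t
  proof -
    have "2 \<le> a * (e * deriv r t)" using d(2)[OF t] a e by (simp add: field_simps)
    moreover have "0 < e * t" using e t by simp
    ultimately have "1 \<le> e * (t + a * deriv r t)" by (simp add: algebra_simps)
    then have "t * 1 \<le> t * (e * (t + a * deriv r t))"
      using t by (intro mult_left_mono) auto
    then show ?thesis
      using w_denom_pos[OF t(1)] by (simp add: w_def a_def pos_divide_le_eq mult_ac)
  qed
  have less: "\<bar>w s - w t\<bar> \<le> e * \<bar>s - t\<bar>" if st: "0 \<le> s" "s < t" "t < d" for s t
  proof (cases "s = 0")
    case True
    moreover have "w 0 = 0" by (simp add: w_def)
    ultimately show ?thesis using w0[of t] w_nonneg[of t] st by simp
  next
    case False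
    obtain z where z: "s < z" "z < t" "w t - w s = (t - s) * w' z"
      using MVT2[OF st(2), of w w'] w_deriv False st by fastforce
    have "\<bar>w t - w s\<bar> \<le> (t - s) * e"
      using z w'b[of z] st by (simp add: abs_mult mult_left_mono)
    then show ?thesis using st by (simp add: mult.commute abs_minus_commute)
  qed
  have "\<bar>w s - w t\<bar> \<le> e * \<bar>s - t\<bar>" if "s \<in> {0..<d}" "t \<in> {0..<d}" for s t
    using less[of s t] less[of t s] that by (cases s t rule: linorder_cases) (auto simp: abs_minus_commute)
  then show ?thesis using d(1) by blast
qed

definition W :: "real \<times> real \<Rightarrow> real" where
  "W p = w (norm p)"

definition DW :: "real \<times> real \<Rightarrow> real \<times> real \<Rightarrow> real" where
  "DW p h = (if p = 0 then 0 else w' (norm p) * (sgn p \<bullet> h))"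

text \<open>At the origin the norm is 1-Lipschitz and \<open>w\<close> has arbitrarily small
  Lipschitz constants, so the derivative is 0. Elsewhere norm and \<open>w\<close> are both
  continuously differentiable.\<close>

lemma W_strict: "has_strict_derivative W (DW p) p"
proof (cases "p = 0")
  case True
  have "DW p = (\<lambda>h. 0)" using True by (auto simp: DW_def)
  moreover have "has_strict_derivative W (\<lambda>h. 0) p"
  proof (rule strict_derivativeI)
    fix e :: real assume "e > 0"
    from w_lipschitz_near_0[OF this] obtain d where d: "d > 0"
      "\<And>s t. s \<in> {0..<d} \<Longrightarrow> t \<in> {0..<d} \<Longrightarrow> \<bar>w s - w t\<bar> \<le> e * \<bar>s - t\<bar>" by blast
    have "norm (W y - W z - 0) \<le> e * norm (y - z)" if "y \<in> ball p d" "z \<in> ball p d" for y z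
    proof -
      have "\<bar>w (norm y) - w (norm z)\<bar> \<le> e * \<bar>norm y - norm z\<bar>"
        using that True by (intro d(2)) auto
      also have "\<dots> \<le> e * norm (y - z)"
        using \<open>e > 0\<close> norm_triangle_ineq3 by (intro mult_left_mono) auto
      finally show ?thesis by (simp add: W_def)
    qed
    then show "\<forall>\<^sub>F q in nhds (p, p). norm (W (fst q) - W (snd q) - 0) \<le> e * norm (fst q - snd q)"
      using d(1) eventually_nhds_diag_ball[where x = p and Q = "\<lambda>y z. norm (W y - W z - 0) \<le> e * norm (y - z)"]
      by blast
  qed simp
  ultimately show ?thesis by simp
next
  case False
  have n: "has_strict_derivative norm (\<lambda>h. sgn p \<bullet> h) p"
  proof (rule strict_derivative_C1[where f' = "\<lambda>p h. sgn p \<bullet> h"])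
    have "\<forall>\<^sub>F y in nhds p. y \<noteq> 0" using False by (rule t1_space_nhds)
    then show "\<forall>\<^sub>F y in nhds p. (norm has_derivative (\<bullet>) (sgn y)) (at y)"
      by eventually_elim
         (rule has_derivative_eq_rhs[OF has_derivative_norm], auto simp: inner_commute)
    fix e :: real assume "e > 0"
    have "filterlim sgn (nhds (sgn p)) (nhds p)"
      using isCont_sgn[OF continuous_ident False] by (simp add: isCont_def tendsto_at_iff_tendsto_nhds)
    then have "\<forall>\<^sub>F y in nhds p. dist (sgn y) (sgn p) < e" using \<open>e > 0\<close> by (rule tendstoD)
    then show "\<forall>\<^sub>F y in nhds p. \<forall>h. norm (sgn y \<bullet> h - sgn p \<bullet> h) \<le> e * norm h"
    proof (eventually_elim, intro allI)
      fix y h assume "dist (sgn y) (sgn p) < e"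
      have "norm (sgn y \<bullet> h - sgn p \<bullet> h) = \<bar>(sgn y - sgn p) \<bullet> h\<bar>" by (simp add: inner_diff_left)
      also have "\<dots> \<le> norm (sgn y - sgn p) * norm h" by (rule Cauchy_Schwarz_ineq2)
      also have "\<dots> \<le> e * norm h" using \<open>dist _ _ < e\<close> by (intro mult_right_mono) (auto simp: dist_norm)
      finally show "norm (sgn y \<bullet> h - sgn p \<bullet> h) \<le> e * norm h" .
    qed
  qed
  have pos: "norm p > 0" using False by simp
  have "has_strict_derivative w (\<lambda>t. w' (norm p) * t) (norm p)"
  proof (rule strict_derivative_real)
    have "\<forall>\<^sub>F y in nhds (norm p). y \<in> {0<..}" using pos by (intro eventually_nhds_in_open) auto
    then show "\<forall>\<^sub>F y in nhds (norm p). (w has_real_derivative w' y) (at y)"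
      by eventually_elim (simp add: w_deriv)
  qed (use w'_cont pos in blast)
  from strict_derivative_compose[OF n this] show ?thesis
    using False by (simp add: W_def [abs_def] DW_def [abs_def])
qed

text \<open>Since \<open>w 0 = 0\<close>, the case distinction in \<open>Sx\<close> is absorbed into
  one strictly differentiable factor.\<close>

lemma Sx_eq: "Sx f r lam \<beta> x e $ i = W (x $ i, e $ i) * (x $ i - g x $ i / \<beta>)"
proof (cases "(x $ i, e $ i) = (0, 0)")
  case True
  then show ?thesis by (simp add: Sx_def W_def w_def)
next
  case False
  define t where "t = sqrt ((x $ i)\<^sup>2 + (e $ i)\<^sup>2)"
  have n: "norm (x $ i, e $ i) = t" by (simp add: norm_Pair t_def)
  then have t: "t > 0" using False by (metis norm_eq_zero norm_ge_zero order_le_less zero_prod_def)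
  have "inverse (1 + 2 * lam / \<beta> * (deriv r t / (2 * t))) = t / (t + lam / \<beta> * deriv r t)"
    using t w_denom_pos[OF t] beta by (simp add: field_simps)
  then show ?thesis using False unfolding Sx_def weight_def W_def w_def n by (simp add: t_def)
qed

definition DSx :: "(real ^ 'n) \<times> (real ^ 'n) \<Rightarrow> (real ^ 'n) \<times> (real ^ 'n) \<Rightarrow> real ^ 'n" where
  "DSx p h = (\<chi> i. W (fst p $ i, snd p $ i) * (fst h $ i - (H (fst p) *v fst h) $ i / \<beta>)
      + DW (fst p $ i, snd p $ i) (fst h $ i, snd h $ i) * (fst p $ i - g (fst p) $ i / \<beta>))"

lemma Sx_strict: "has_strict_derivative (\<lambda>p. Sx f r lam \<beta> (fst p) (snd p)) (DSx p) p"
proof (rule strict_derivative_vec)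
  fix i
  have lin: "bounded_linear (\<lambda>p :: (real ^ 'n) \<times> (real ^ 'n). (fst p $ i, snd p $ i))"
    by (intro bounded_linear_Pair bounded_linear_compose[OF bounded_linear_vec_nth] bounded_linear_fst bounded_linear_snd)
  have lin1: "bounded_linear (\<lambda>p :: (real ^ 'n) \<times> (real ^ 'n). fst p $ i)"
    by (intro bounded_linear_compose[OF bounded_linear_vec_nth] bounded_linear_fst)
  have lin2: "bounded_linear (\<lambda>y :: real ^ 'n. y $ i / \<beta>)"
    by (rule bounded_linear_compose[OF bounded_linear_divide bounded_linear_vec_nth])
  have 1: "has_strict_derivative (\<lambda>p. W (fst p $ i, snd p $ i))
      (\<lambda>h. DW (fst p $ i, snd p $ i) (fst h $ i, snd h $ i)) p"
    by (rule strict_derivative_compose[OF strict_derivative_linear[OF lin] W_strict])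
  have 2: "has_strict_derivative (\<lambda>p. g (fst p)) (\<lambda>h. H (fst p) *v fst h) p"
    by (rule strict_derivative_compose[OF strict_derivative_linear[OF bounded_linear_fst] gradient_strict])
  have 3: "has_strict_derivative (\<lambda>p. fst p $ i - g (fst p) $ i / \<beta>)
      (\<lambda>h. fst h $ i - (H (fst p) *v fst h) $ i / \<beta>) p"
    by (rule strict_derivative_diff[OF strict_derivative_linear[OF lin1]
          strict_derivative_bounded_linear[OF lin2 2]])
  from strict_derivative_mult[OF 1 3]
  show "has_strict_derivative (\<lambda>p. Sx f r lam \<beta> (fst p) (snd p) $ i) (\<lambda>h. DSx p h $ i) p"
    by (simp add: Sx_eq DSx_def)
qed

abbreviation "T \<equiv> dirl2_step f r lam \<alpha> \<beta> \<mu>"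

definition DT :: "(real ^ 'n) \<times> (real ^ 'n) \<Rightarrow> (real ^ 'n) \<times> (real ^ 'n) \<Rightarrow> (real ^ 'n) \<times> (real ^ 'n)" where
  "DT p h = ((1 - \<alpha>) *\<^sub>R fst h + \<alpha> *\<^sub>R DSx p h, c *\<^sub>R snd h)"

lemma T_strict: "has_strict_derivative T (DT p) p"
proof -
  have "has_strict_derivative (\<lambda>p. ((1 - \<alpha>) *\<^sub>R fst p + \<alpha> *\<^sub>R Sx f r lam \<beta> (fst p) (snd p), c *\<^sub>R snd p)) (DT p) p"
    unfolding DT_def [abs_def]
    by (intro strict_derivative_Pair strict_derivative_add
         strict_derivative_bounded_linear[OF bounded_linear_scaleR_right Sx_strict]
         strict_derivative_linear bounded_linear_const_scaleR bounded_linear_fst bounded_linear_snd)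
  moreover have "T = (\<lambda>p. ((1 - \<alpha>) *\<^sub>R fst p + \<alpha> *\<^sub>R Sx f r lam \<beta> (fst p) (snd p), c *\<^sub>R snd p))"
    by (auto simp: dirl2_step_def)
  ultimately show ?thesis by simp
qed

end

section \<open>Descent and invertibility along the iteration\<close>

text \<open>Continuous induction: the infimum of the bad parameters is good by continuity from the
  left, and \<open>step\<close> then excludes bad ones immediately to its right. \<open>step\<close>
  may use the bound on the whole interval reached so far, since it speaks about a segment.\<close>

lemma interval_barrier:
  fixes \<phi> :: "real \<Rightarrow> real"
  assumes cont: "continuous_on {0..a} \<phi>"
    and step: "\<And>s. 0 \<le> s \<Longrightarrow> s \<le> a \<Longrightarrow> (\<And>\<tau>. 0 \<le> \<tau> \<Longrightarrow> \<tau> \<le> s \<Longrightarrow> \<phi> \<tau> \<le> \<phi> 0) \<Longrightarrow>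
        \<exists>\<eta>>0. \<forall>\<tau>. s < \<tau> \<and> \<tau> < s + \<eta> \<longrightarrow> \<phi> \<tau> \<le> \<phi> 0"
    and t: "0 \<le> t" "t \<le> a"
  shows "\<phi> t \<le> \<phi> 0"
proof (rule ccontr)
  assume nt: "\<not> \<phi> t \<le> \<phi> 0"
  define B where "B = {\<tau>. 0 \<le> \<tau> \<and> \<tau> \<le> a \<and> \<phi> \<tau> > \<phi> 0}"
  have B: "t \<in> B" using nt t by (simp add: B_def)
  have bdd: "bdd_below B" by (rule bdd_belowI[of _ 0]) (simp add: B_def)
  define s where "s = Inf B"
  have s0: "0 \<le> s" unfolding s_def using B by (intro cInf_greatest) (auto simp: B_def)
  have st: "s \<le> t" unfolding s_def using B bdd by (intro cInf_lower)
  have below: "\<phi> \<tau> \<le> \<phi> 0" if "0 \<le> \<tau>" "\<tau> < s" for \<tau>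
  proof (rule ccontr)
    assume "\<not> \<phi> \<tau> \<le> \<phi> 0"
    then have "\<tau> \<in> B" using that st t by (simp add: B_def)
    then have "s \<le> \<tau>" unfolding s_def using bdd by (rule cInf_lower)
    with that show False by simp
  qed
  have at_s: "\<phi> s \<le> \<phi> 0"
  proof (rule ccontr)
    assume c: "\<not> \<phi> s \<le> \<phi> 0"
    then have "0 < s" using s0 by (cases "s = 0") auto
    have "s \<in> {0..a}" using s0 st t by simp
    moreover have "\<phi> s - \<phi> 0 > 0" using c by simp
    ultimately obtain d where d: "d > 0" "\<And>y. y \<in> {0..a} \<Longrightarrow> dist y s < d \<Longrightarrow> dist (\<phi> y) (\<phi> s) < \<phi> s - \<phi> 0"
      using cont unfolding continuous_on_iff by blast
    define y where "y = max 0 (s - d / 2)"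
    have y: "0 \<le> y" "y < s" "y \<in> {0..a}" "dist y s < d"
      using d(1) \<open>0 < s\<close> st t by (auto simp: y_def dist_real_def)
    from d(2)[OF y(3,4)] below[OF y(1,2)] show False by (simp add: dist_real_def)
  qed
  have "\<phi> \<tau> \<le> \<phi> 0" if "0 \<le> \<tau>" "\<tau> \<le> s" for \<tau>
    using below[of \<tau>] at_s that by (cases "\<tau> = s") auto
  then obtain \<eta> where \<eta>: "\<eta> > 0" "\<And>\<tau>. s < \<tau> \<Longrightarrow> \<tau> < s + \<eta> \<Longrightarrow> \<phi> \<tau> \<le> \<phi> 0"
    using step[of s] s0 st t by auto
  have "s + \<eta> \<le> \<tau>" if "\<tau> \<in> B" for \<tau>
  proof (rule ccontr)
    assume "\<not> s + \<eta> \<le> \<tau>"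
    moreover have "s \<le> \<tau>" unfolding s_def using that bdd by (rule cInf_lower)
    ultimately have "\<phi> \<tau> \<le> \<phi> 0" using \<eta>(2)[of \<tau>] at_s by (cases "\<tau> = s") auto
    with that show False by (simp add: B_def)
  qed
  then have "s + \<eta> \<le> s" unfolding s_def using B by (intro cInf_greatest) auto
  with \<eta>(1) show False by simp
qed

context dirl2_setting
begin

abbreviation "F \<equiv> objective f r lam"
abbreviation "FS \<equiv> smoothed_objective f r lam"

lemma f_isCont: "isCont f x"
  using f_diff[of x] by (rule differentiable_imp_continuous_within)

lemma F_isCont: "isCont F x"
proof -
  have c: "continuous_on {0..} r" using A1 by (simp add: A1_def)
  have "continuous_on UNIV (\<lambda>x :: real ^ 'n. r \<bar>x $ i\<bar>)" for i
    by (rule continuous_on_compose2[OF c]) (auto intro!: continuous_intros)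
  moreover have "continuous_on UNIV f" using f_isCont by (simp add: continuous_on_eq_continuous_at)
  ultimately have "continuous_on UNIV F"
    unfolding objective_def [abs_def] by (intro continuous_intros) auto
  then show ?thesis by (simp add: continuous_on_eq_continuous_at)
qed

lemma FS_mono:
  assumes "\<And>i. \<bar>e $ i\<bar> \<le> \<bar>e' $ i\<bar>"
  shows "FS x e \<le> FS x e'"
  unfolding smoothed_objective_def
  using lam assms by (intro add_left_mono mult_left_mono sum_mono r_mono)
    (auto simp: abs_le_square_iff)

lemma F_le_FS: "F x \<le> FS x e"
proof -
  have "FS x 0 = F x" by (simp add: smoothed_objective_def objective_def)
  moreover have "FS x 0 \<le> FS x e" by (rule FS_mono) simp
  ultimately show ?thesis by simp
qed

lemma r_tangent:
  assumes "s \<ge> 0" "t > 0"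
  shows "r s \<le> r t + deriv r t * (s - t)"
proof -
  have conv: "convex_on {0..} (\<lambda>x. - r x)" using A1 by (simp add: A1_def concave_on_def)
  have "((\<lambda>x. - r x) has_real_derivative (- deriv r t)) (at t within {0..})"
    by (rule has_field_derivative_at_within[OF DERIV_minus[OF r_deriv[OF assms(2)]]])
  from convex_on_imp_above_tangent[OF conv _ _ _ this, of s]
  have "- r s - - r t \<ge> - deriv r t * (s - t)" using assms by simp
  then show ?thesis by (simp add: algebra_simps)
qed

section \<open>Quadratic majorants and descent of the smoothed objective\<close>

definition u :: "real ^ 'n \<Rightarrow> real ^ 'n \<Rightarrow> 'n \<Rightarrow> real" where
  "u x e i = weight r (x $ i) (e $ i)"

lemma root_pos: "e > 0 \<Longrightarrow> sqrt (s\<^sup>2 + e\<^sup>2) > (0::real)"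
  by (simp add: add_nonneg_pos)

lemma u_nonneg: "e $ i > 0 \<Longrightarrow> u x e i \<ge> 0"
  unfolding u_def weight_def using root_pos r_deriv_nonneg by (simp add: root_pos less_imp_le)

text \<open>Concavity of r composed with the square root, in disguise: the tangent bound for r is
  combined with s - t \<le> (s^2 - t^2) / (2 t), using r' \<ge> 0. The slope with respect to the
  squared variable is exactly the weight of the iteration.\<close>

lemma r_root_majorant:
  assumes "e > 0"
  shows "r (sqrt (y\<^sup>2 + e\<^sup>2)) \<le> r (sqrt (x\<^sup>2 + e\<^sup>2)) + weight r x e * (y\<^sup>2 - x\<^sup>2)"
proof -
  define s where "s = sqrt (y\<^sup>2 + e\<^sup>2)"
  define t where "t = sqrt (x\<^sup>2 + e\<^sup>2)"
  have pos: "s > 0" "t > 0" unfolding s_def t_def using root_pos assms by auto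
  have sq: "y\<^sup>2 - x\<^sup>2 = s\<^sup>2 - t\<^sup>2" by (simp add: s_def t_def)
  have "0 \<le> (s - t)\<^sup>2" by simp
  then have "s - t \<le> (s\<^sup>2 - t\<^sup>2) / (2 * t)"
    using pos by (simp add: field_simps power2_eq_square)
  then have "deriv r t * (s - t) \<le> deriv r t * ((s\<^sup>2 - t\<^sup>2) / (2 * t))"
    using r_deriv_nonneg pos by (intro mult_left_mono) auto
  also have "\<dots> = weight r x e * (y\<^sup>2 - x\<^sup>2)" by (simp add: weight_def sq flip: t_def)
  finally show ?thesis using r_tangent[of s t] pos by (simp flip: s_def t_def)
qed

lemma FS_majorant:
  assumes "\<And>i. e $ i > 0"
  shows "FS (x + s *\<^sub>R d) e \<le> FS x e + (f (x + s *\<^sub>R d) - f x)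
    + (\<Sum>i\<in>UNIV. lam * u x e i * (2 * s * x $ i * d $ i + s\<^sup>2 * (d $ i)\<^sup>2))"
proof -
  have "lam * (\<Sum>i\<in>UNIV. r (sqrt (((x + s *\<^sub>R d) $ i)\<^sup>2 + (e $ i)\<^sup>2))) \<le>
     lam * (\<Sum>i\<in>UNIV. r (sqrt ((x $ i)\<^sup>2 + (e $ i)\<^sup>2)) + u x e i * (((x + s *\<^sub>R d) $ i)\<^sup>2 - (x $ i)\<^sup>2))"
    unfolding u_def using lam assms by (intro mult_left_mono sum_mono r_root_majorant) auto
  also have "\<dots> = lam * (\<Sum>i\<in>UNIV. r (sqrt ((x $ i)\<^sup>2 + (e $ i)\<^sup>2)))
      + (\<Sum>i\<in>UNIV. lam * u x e i * (2 * s * x $ i * d $ i + s\<^sup>2 * (d $ i)\<^sup>2))"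
    by (simp add: sum.distrib sum_distrib_left algebra_simps power2_eq_square)
  finally show ?thesis by (simp add: smoothed_objective_def)
qed

text \<open>The first-order condition of the weighted quadratic subproblem minimized by
  \<open>Sx\<close>, recovered from the closed formula by clearing denominators.\<close>

lemma Sx_optimality:
  assumes "e $ i > 0"
  shows "\<beta> * (Sx f r lam \<beta> x e $ i - x $ i) + g x $ i + 2 * lam * u x e i * Sx f r lam \<beta> x e $ i = 0"
proof -
  have "1 + 2 * lam / \<beta> * u x e i > 0"
    using u_nonneg[of e i x] assms lam beta by (simp add: add_pos_nonneg)
  moreover have "Sx f r lam \<beta> x e $ i = inverse (1 + 2 * lam / \<beta> * u x e i) * (x $ i - g x $ i / \<beta>)"
    using assms by (simp add: Sx_def u_def)
  ultimately have "Sx f r lam \<beta> x e $ i * (1 + 2 * lam / \<beta> * u x e i) = x $ i - g x $ i / \<beta>"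
    by simp
  then have "\<beta> * (Sx f r lam \<beta> x e $ i * (1 + 2 * lam / \<beta> * u x e i)) = \<beta> * (x $ i - g x $ i / \<beta>)"
    by simp
  then show ?thesis using beta by (simp add: algebra_simps)
qed

lemma f_line_deriv: "((\<lambda>s. f (x + s *\<^sub>R d)) has_real_derivative (g (x + s *\<^sub>R d) \<bullet> d)) (at s)"
proof -
  have "((\<lambda>t. f (x + t *\<^sub>R d)) has_derivative (\<lambda>k. g (x + s *\<^sub>R d) \<bullet> (k *\<^sub>R d))) (at s)"
    by (rule has_derivative_compose[OF _ f_derivative]) (auto intro!: derivative_eq_intros)
  then show ?thesis by (simp add: has_field_derivative_def mult_commute_abs)
qed

lemma f_descent:
  assumes L: "L-lipschitz_on D g" and s: "0 \<le> s"
    and seg: "\<And>\<tau>. 0 \<le> \<tau> \<Longrightarrow> \<tau> \<le> s \<Longrightarrow> x + \<tau> *\<^sub>R d \<in> D"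
  shows "f (x + s *\<^sub>R d) \<le> f x + s * (g x \<bullet> d) + L / 2 * s\<^sup>2 * (norm d)\<^sup>2"
proof -
  define \<psi> where "\<psi> \<tau> = f (x + \<tau> *\<^sub>R d) - \<tau> * (g x \<bullet> d) - L / 2 * \<tau>\<^sup>2 * (norm d)\<^sup>2" for \<tau>
  have "\<psi> s \<le> \<psi> 0"
  proof (rule DERIV_nonpos_imp_nonincreasing[OF s])
    fix \<tau> assume \<tau>: "0 \<le> \<tau>" "\<tau> \<le> s"
    have "(\<psi> has_real_derivative (g (x + \<tau> *\<^sub>R d) \<bullet> d - g x \<bullet> d - L * \<tau> * (norm d)\<^sup>2)) (at \<tau>)"
      unfolding \<psi>_def by (auto intro!: derivative_eq_intros f_line_deriv)
    moreover have "g (x + \<tau> *\<^sub>R d) \<bullet> d - g x \<bullet> d - L * \<tau> * (norm d)\<^sup>2 \<le> 0"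
    proof -
      have "norm (g (x + \<tau> *\<^sub>R d) - g x) \<le> L * norm (\<tau> *\<^sub>R d)"
        using lipschitz_onD[OF L seg[OF \<tau>] seg[of 0]] s by (simp add: dist_norm)
      then have "norm (g (x + \<tau> *\<^sub>R d) - g x) * norm d \<le> L * (\<tau> * norm d) * norm d"
        using \<tau> by (intro mult_right_mono) auto
      moreover have "g (x + \<tau> *\<^sub>R d) \<bullet> d - g x \<bullet> d \<le> norm (g (x + \<tau> *\<^sub>R d) - g x) * norm d"
        using norm_cauchy_schwarz[of "g (x + \<tau> *\<^sub>R d) - g x" d] by (simp add: inner_diff_left)
      ultimately show ?thesis by (simp add: power2_eq_square algebra_simps)
    qed
    ultimately show "\<exists>y. (\<psi> has_real_derivative y) (at \<tau>) \<and> y \<le> 0" by blast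
  qed
  then show ?thesis by (simp add: \<psi>_def)
qed

lemma FS_line_isCont: "continuous_on S (\<lambda>s. FS (x + s *\<^sub>R d) e)"
proof -
  have c: "continuous_on {0..} r" using A1 by (simp add: A1_def)
  have "continuous_on S (\<lambda>s. r (sqrt (((x + s *\<^sub>R d) $ i)\<^sup>2 + (e $ i)\<^sup>2)))" for i
    by (rule continuous_on_compose2[OF c]) (auto intro!: continuous_intros)
  moreover have "continuous_on S (\<lambda>s. f (x + s *\<^sub>R d))"
    by (intro DERIV_continuous_on[OF has_field_derivative_at_within[OF f_line_deriv]])
  ultimately show ?thesis unfolding smoothed_objective_def by (intro continuous_intros) auto
qed

text \<open>The gradient is Lipschitz on the level set only, so the segment from \<open>x\<close> to the next iterate has to be
  kept inside it while the descent estimate is being proved.\<close>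

lemma FS_descent:
  assumes e: "\<And>i. e $ i > 0" and C: "FS x e \<le> C"
    and L: "L-lipschitz_on {y. F y \<le> C} g" and \<beta>: "\<beta> > \<alpha> * L / 2"
  defines "d \<equiv> Sx f r lam \<beta> x e - x"
  shows "FS (x + \<alpha> *\<^sub>R d) e \<le> FS x e - \<alpha> * (\<beta> - L * \<alpha> / 2) * (norm d)\<^sup>2"
proof -
  define Q where "Q = (\<Sum>i\<in>UNIV. lam * u x e i * (2 * x $ i * d $ i))"
  define R where "R = (\<Sum>i\<in>UNIV. lam * u x e i * (d $ i)\<^sup>2)"
  have R: "R \<ge> 0" unfolding R_def using lam e by (intro sum_nonneg mult_nonneg_nonneg u_nonneg) auto
  \<comment> \<open>The optimality condition is tested with \<open>d\<close> itself; this turns the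
    slope of the majorant at 0 into a negative multiple of |d|^2 minus the curvature term
    \<open>2 * R\<close>.\<close>
  have opt: "g x \<bullet> d + Q = - \<beta> * (norm d)\<^sup>2 - 2 * R"
  proof -
    have "g x $ i * d $ i + lam * u x e i * (2 * x $ i * d $ i) = - \<beta> * (d $ i * d $ i) - 2 * (lam * u x e i * (d $ i)\<^sup>2)" for i
    proof -
      have "(\<beta> * d $ i + g x $ i + 2 * lam * u x e i * (x $ i + d $ i)) * d $ i = 0"
        using Sx_optimality[of e i x] e by (simp add: d_def)
      then show ?thesis by (simp add: algebra_simps power2_eq_square)
    qed
    then have "(\<Sum>i\<in>UNIV. g x $ i * d $ i + lam * u x e i * (2 * x $ i * d $ i))
      = (\<Sum>i\<in>UNIV. - \<beta> * (d $ i * d $ i) - 2 * (lam * u x e i * (d $ i)\<^sup>2))" by simp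
    moreover have "(norm d)\<^sup>2 = (\<Sum>i\<in>UNIV. d $ i * d $ i)"
      by (simp add: power2_norm_eq_inner inner_vec_def)
    ultimately show ?thesis
      by (simp add: Q_def R_def inner_vec_def sum.distrib sum_subtractf sum_distrib_left sum_negf)
  qed
  have maj: "FS (x + s *\<^sub>R d) e \<le> FS x e + (f (x + s *\<^sub>R d) - f x) + s * Q + s\<^sup>2 * R" for s
    using FS_majorant[OF e, of x s d]
    by (simp add: Q_def R_def sum_distrib_left sum.distrib algebra_simps)
  have est: "FS (x + s *\<^sub>R d) e \<le> FS x e - s * (\<beta> - L * s / 2) * (norm d)\<^sup>2"
    if s: "0 \<le> s" "s \<le> \<alpha>" and le: "\<And>\<tau>. 0 \<le> \<tau> \<Longrightarrow> \<tau> \<le> s \<Longrightarrow> FS (x + \<tau> *\<^sub>R d) e \<le> FS x e" for s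
  proof -
    have "x + \<tau> *\<^sub>R d \<in> {y. F y \<le> C}" if "0 \<le> \<tau>" "\<tau> \<le> s" for \<tau>
      using le[OF that] C F_le_FS[of "x + \<tau> *\<^sub>R d" e] by simp
    from f_descent[OF L s(1) this]
    have "FS (x + s *\<^sub>R d) e \<le> FS x e + s * (g x \<bullet> d + Q) + L / 2 * s\<^sup>2 * (norm d)\<^sup>2 + s\<^sup>2 * R"
      using maj[of s] by (simp add: algebra_simps)
    also have "\<dots> = FS x e - s * (\<beta> - L * s / 2) * (norm d)\<^sup>2 - s * ((2 - s) * R)"
      unfolding opt by (simp add: algebra_simps power2_eq_square)
    also have "\<dots> \<le> FS x e - s * (\<beta> - L * s / 2) * (norm d)\<^sup>2"
      using s alpha R by simp
    finally show ?thesis .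
  qed
  have "FS (x + t *\<^sub>R d) e \<le> FS (x + 0 *\<^sub>R d) e" if t: "0 \<le> t" "t \<le> \<alpha>" for t
  proof (cases "d = 0")
    case True
    then show ?thesis by simp
  next
    case d: False
    then have nd: "(norm d)\<^sup>2 > 0" by simp
    show ?thesis
    proof (rule interval_barrier[where \<phi> = "\<lambda>s. FS (x + s *\<^sub>R d) e" and a = \<alpha>, OF FS_line_isCont _ t])
      fix s assume s: "0 \<le> s" "s \<le> \<alpha>"
        and le: "\<And>\<tau>. 0 \<le> \<tau> \<Longrightarrow> \<tau> \<le> s \<Longrightarrow> FS (x + \<tau> *\<^sub>R d) e \<le> FS (x + 0 *\<^sub>R d) e"
      show "\<exists>\<eta>>0. \<forall>\<tau>. s < \<tau> \<and> \<tau> < s + \<eta> \<longrightarrow> FS (x + \<tau> *\<^sub>R d) e \<le> FS (x + 0 *\<^sub>R d) e"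
      proof (cases "s = 0")
        case True
        \<comment> \<open>At the start of the segment \<open>est\<close> carries no decrease and
          \<open>x\<close> may lie on the boundary of the level set. Here the negative slope of the
          majorant starts the motion.\<close>
        define h where "h = (\<lambda>s. f (x + s *\<^sub>R d) + s * Q + s\<^sup>2 * R)"
        have "(h has_real_derivative (g (x + 0 *\<^sub>R d) \<bullet> d + Q)) (at 0)"
          unfolding h_def by (auto intro!: derivative_eq_intros f_line_deriv)
        moreover have "g (x + 0 *\<^sub>R d) \<bullet> d + Q < 0"
        proof -
          have "\<beta> * (norm d)\<^sup>2 > 0" using beta nd by simp
          then show ?thesis using opt R by simp
        qed
        ultimately obtain \<eta> where \<eta>: "\<eta> > 0" "\<And>k. 0 < k \<Longrightarrow> k < \<eta> \<Longrightarrow> h (0 + k) < h 0"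
          using DERIV_neg_dec_right by blast
        show ?thesis
        proof (intro exI[of _ \<eta>] conjI allI impI)
          fix \<tau> assume "s < \<tau> \<and> \<tau> < s + \<eta>"
          then have "h \<tau> < h 0" using \<eta>(2)[of \<tau>] True by simp
          then show "FS (x + \<tau> *\<^sub>R d) e \<le> FS (x + 0 *\<^sub>R d) e"
            using maj[of \<tau>] by (simp add: h_def)
        qed (fact \<eta>)
      next
        case False
        \<comment> \<open>For \<open>s > 0\<close> the bound on \<open>\<beta>\<close> makes the
          decrease in \<open>est\<close> strict, and continuity carries it a little beyond
          \<open>s\<close>.\<close>
        have "L \<ge> 0" using L by (rule lipschitz_on_nonneg)
        then have "L * s / 2 \<le> \<alpha> * L / 2" using s mult_left_mono[of s \<alpha> L] by (simp add: mult.commute)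
        then have "\<beta> - L * s / 2 > 0" using \<beta> by simp
        then have "s * (\<beta> - L * s / 2) * (norm d)\<^sup>2 > 0" using s False nd by simp
        moreover have "FS (x + s *\<^sub>R d) e \<le> FS x e - s * (\<beta> - L * s / 2) * (norm d)\<^sup>2"
          using est[OF s] le by simp
        ultimately have lt: "FS (x + s *\<^sub>R d) e < FS x e" by linarith
        have "isCont (\<lambda>s. FS (x + s *\<^sub>R d) e) s"
          using FS_line_isCont[of UNIV] by (simp add: continuous_on_eq_continuous_at)
        then have "((\<lambda>s. FS (x + s *\<^sub>R d) e) \<longlongrightarrow> FS (x + s *\<^sub>R d) e) (nhds s)"
          using tendsto_at_iff_tendsto_nhds[of "\<lambda>s. FS (x + s *\<^sub>R d) e" s] by (simp add: isCont_def)
        then have "\<forall>\<^sub>F \<tau> in nhds s. FS (x + \<tau> *\<^sub>R d) e < FS x e"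
          using lt by (rule order_tendstoD)
        then obtain \<eta> where "\<eta> > 0" "\<And>\<tau>. dist \<tau> s < \<eta> \<Longrightarrow> FS (x + \<tau> *\<^sub>R d) e < FS x e"
          unfolding eventually_nhds_metric by blast
        then show ?thesis
          by (intro exI[of _ \<eta>]) (auto simp: dist_real_def less_imp_le)
      qed
    qed
  qed
  with est[of \<alpha>] alpha show ?thesis by simp
qed

lemma T_eq:
  "T (x, e) = (x + \<alpha> *\<^sub>R (Sx f r lam \<beta> x e - x), c *\<^sub>R e)"
  by (simp add: dirl2_step_def algebra_simps)

lemma T_descent:
  assumes e: "\<And>i. e $ i > 0" and C: "FS x e \<le> C"
    and L: "L-lipschitz_on {y. F y \<le> C} g" and \<beta>: "\<beta> > \<alpha> * L / 2"
    and T: "T (x, e) = (x', e')"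
  shows "FS x' e' \<le> FS x e" and "x' \<noteq> x \<Longrightarrow> FS x' e' < FS x e"
proof -
  define d where "d = Sx f r lam \<beta> x e - x"
  have x': "x' = x + \<alpha> *\<^sub>R d" "e' = c *\<^sub>R e" using T by (auto simp: T_eq d_def)
  have "\<bar>c * e $ i\<bar> \<le> \<bar>e $ i\<bar>" for i
    using c_bounds by (simp add: abs_mult mult_left_le_one_le)
  then have 1: "FS x' e' \<le> FS x' e"
    unfolding x'(2) by (intro FS_mono) simp
  have 2: "FS x' e \<le> FS x e - \<alpha> * (\<beta> - L * \<alpha> / 2) * (norm d)\<^sup>2"
    using FS_descent[OF e C L \<beta>] by (simp add: x' d_def)
  have pos: "\<alpha> * (\<beta> - L * \<alpha> / 2) > 0" using alpha \<beta> by (simp add: mult.commute)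
  then have "\<alpha> * (\<beta> - L * \<alpha> / 2) * (norm d)\<^sup>2 \<ge> 0" by simp
  with 1 2 show "FS x' e' \<le> FS x e" by linarith
  assume "x' \<noteq> x"
  then have "d \<noteq> 0" by (auto simp: x')
  then have "\<alpha> * (\<beta> - L * \<alpha> / 2) * (norm d)\<^sup>2 > 0" using pos by simp
  with 1 2 show "FS x' e' < FS x e" by linarith
qed

lemma snd_T_pow: "snd ((T ^^ k) p) = c ^ k *\<^sub>R snd p"
proof (induction k)
  case (Suc k)
  obtain x e where "(T ^^ k) p = (x, e)" by fastforce
  then show ?case using Suc by (simp add: T_eq)
qed simp

section \<open>Injectivity of the derivative over the level set\<close>

text \<open>Equality forces r to agree at |x_i| and at the larger smoothed radius; by concavity and
  monotonicity its derivative vanishes at the latter. This describes the starting points for which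
  \<open>x\<close> lies on the boundary of its own level set.\<close>

lemma weights_vanish:
  assumes e: "\<And>i. e $ i > 0" and eq: "F x = FS x e"
  shows "u x e i = 0"
proof -
  let ?t = "\<lambda>i. sqrt ((x $ i)\<^sup>2 + (e $ i)\<^sup>2)"
  have "lam * (\<Sum>i\<in>UNIV. r (?t i) - r \<bar>x $ i\<bar>) = 0"
    using eq[symmetric] by (simp add: objective_def smoothed_objective_def sum_subtractf right_diff_distrib)
  then have "(\<Sum>i\<in>UNIV. r (?t i) - r \<bar>x $ i\<bar>) = 0" using lam by simp
  moreover have "r (?t i) - r \<bar>x $ i\<bar> \<ge> 0" for i
    using r_mono[of "\<bar>x $ i\<bar>" "?t i"] by simp
  ultimately have "r (?t i) = r \<bar>x $ i\<bar>"
    by (subst (asm) sum_nonneg_eq_0_iff) auto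
  moreover have t: "?t i > 0" "?t i > \<bar>x $ i\<bar>"
  proof -
    show "?t i > 0" using e by (rule root_pos)
    have "sqrt ((x $ i)\<^sup>2) < ?t i" using e[of i] by (intro real_sqrt_less_mono) simp
    then show "?t i > \<bar>x $ i\<bar>" by simp
  qed
  ultimately have "0 \<le> deriv r (?t i) * (\<bar>x $ i\<bar> - ?t i)"
    using r_tangent[of "\<bar>x $ i\<bar>" "?t i"] by simp
  then have "deriv r (?t i) \<le> 0" using t(2) by (simp add: zero_le_mult_iff)
  then have "deriv r (?t i) = 0" using r_deriv_nonneg[OF t(1)] by simp
  then show ?thesis by (simp add: u_def weight_def)
qed

text \<open>Difference quotients of \<open>Smap\<close> along \<open>v\<close> with fixed
  \<open>e\<close> are bounded by the Lipschitz constant. Only small positive multiples of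
  \<open>v\<close> are used, so that boundary points are covered.\<close>

lemma DSx_directional_bound:
  assumes lip: "L_S-lipschitz_on (D \<times> E) (Smap f r lam \<beta> \<mu>)"
    and x: "x \<in> D" "e \<in> E" and v: "\<forall>\<^sub>F s in at_right 0. x + s *\<^sub>R v \<in> D"
  shows "norm (DSx (x, e) (v, 0)) \<le> L_S * norm v"
proof (rule field_le_epsilon)
  fix \<epsilon>' :: real assume "\<epsilon>' > 0"
  define \<epsilon> where "\<epsilon> = \<epsilon>' / (norm v + 1)"
  have n: "norm v + 1 > 0" by (simp add: add_nonneg_pos)
  then have \<epsilon>: "\<epsilon> > 0" using \<open>\<epsilon>' > 0\<close> by (simp add: \<epsilon>_def)
  obtain d where d: "d > 0" "\<And>y z. y \<in> ball (x, e) d \<Longrightarrow> z \<in> ball (x, e) d \<Longrightarrow>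
      norm (Sx f r lam \<beta> (fst y) (snd y) - Sx f r lam \<beta> (fst z) (snd z) - DSx (x, e) (y - z)) \<le> \<epsilon> * norm (y - z)"
    using strict_derivative_ball[OF Sx_strict \<epsilon>, of "(x, e)"] by blast
  have "\<forall>\<^sub>F s in at_right 0. s < d / (norm v + 1)"
    using d(1) n by (intro eventually_at_rightI[of 0 "d / (norm v + 1)"]) auto
  moreover have "\<forall>\<^sub>F s in at_right 0. (0::real) < s" by (rule eventually_at_right_less)
  ultimately have "\<forall>\<^sub>F s in at_right 0. x + s *\<^sub>R v \<in> D \<and> s < d / (norm v + 1) \<and> 0 < s"
    using v by eventually_elim auto
  then obtain s where s: "x + s *\<^sub>R v \<in> D" "s < d / (norm v + 1)" "0 < s"
    using eventually_happens[of _ "at_right (0::real)"] trivial_limit_at_right_real by blast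
  have "s * norm v < d"
  proof -
    have "s * norm v \<le> s * (norm v + 1)" using s by simp
    also have "\<dots> < d" using s n by (simp add: pos_less_divide_eq)
    finally show ?thesis .
  qed
  then have 1: "norm (Sx f r lam \<beta> (x + s *\<^sub>R v) e - Sx f r lam \<beta> x e - DSx (x, e) (s *\<^sub>R v, 0)) \<le> \<epsilon> * (s * norm v)"
    using d(2)[of "(x + s *\<^sub>R v, e)" "(x, e)"] d(1) s(3) by (simp add: dist_Pair_Pair dist_norm norm_Pair)
  have "dist (Smap f r lam \<beta> \<mu> (x + s *\<^sub>R v, e)) (Smap f r lam \<beta> \<mu> (x, e)) \<le> L_S * dist (x + s *\<^sub>R v, e) (x, e)"
    using x s(1) by (intro lipschitz_onD[OF lip]) auto
  then have 2: "norm (Sx f r lam \<beta> (x + s *\<^sub>R v) e - Sx f r lam \<beta> x e) \<le> L_S * (s * norm v)"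
    using s(3) by (simp add: Smap_def dist_Pair_Pair dist_norm norm_Pair)
  interpret D: bounded_linear "DSx (x, e)" using strict_derivativeD(1)[OF Sx_strict] .
  have sD: "DSx (x, e) (s *\<^sub>R v, 0) = s *\<^sub>R DSx (x, e) (v, 0)"
    using D.scaleR[of s "(v, 0)"] by simp
  have "s * norm (DSx (x, e) (v, 0)) = norm (DSx (x, e) (s *\<^sub>R v, 0))" using s(3) by (simp add: sD)
  also have "\<dots> \<le> norm (Sx f r lam \<beta> (x + s *\<^sub>R v) e - Sx f r lam \<beta> x e)
      + norm (Sx f r lam \<beta> (x + s *\<^sub>R v) e - Sx f r lam \<beta> x e - DSx (x, e) (s *\<^sub>R v, 0))"
    by (metis norm_triangle_sub norm_minus_commute)
  also have "\<dots> \<le> L_S * (s * norm v) + \<epsilon> * (s * norm v)" using 1 2 by simp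
  also have "\<dots> = s * (L_S * norm v + \<epsilon> * norm v)" by (simp add: algebra_simps)
  finally have "norm (DSx (x, e) (v, 0)) \<le> L_S * norm v + \<epsilon> * norm v" using s(3) by simp
  also have "\<epsilon> * norm v \<le> \<epsilon>'"
    using n \<open>\<epsilon>' > 0\<close> by (simp add: \<epsilon>_def field_simps)
  finally show "norm (DSx (x, e) (v, 0)) \<le> L_S * norm v + \<epsilon>'" by simp
qed

text \<open>The derivative is block triangular and \<open>c\<close> is nonzero, so a kernel vector
  has no smoothing component. Its other component satisfies (1 - \<alpha>) |v| \<le> \<alpha> L_S
  |v|, while \<alpha> (1 + L_S) < 1.\<close>

lemma inj_DT:
  assumes b: "\<And>v. norm (DSx (x, e) (v, 0)) \<le> L_S * norm v" and L: "L_S \<ge> 0" "\<alpha> < 1 / (1 + L_S)"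
  shows "inj (DT (x, e))"
proof -
  have lin: "linear (DT (x, e))"
    using strict_derivativeD(1)[OF T_strict] by (rule bounded_linear.linear)
  have "h = 0" if h: "DT (x, e) h = 0" for h
  proof -
    obtain v k where hk: "h = (v, k)" by fastforce
    have k: "k = 0" using h c_bounds by (simp add: DT_def hk prod_eq_iff)
    have "(1 - \<alpha>) *\<^sub>R v + \<alpha> *\<^sub>R DSx (x, e) (v, 0) = 0" using h by (simp add: DT_def hk k prod_eq_iff)
    then have "(1 - \<alpha>) *\<^sub>R v = - (\<alpha> *\<^sub>R DSx (x, e) (v, 0))" by (simp add: eq_neg_iff_add_eq_0)
    then have "norm ((1 - \<alpha>) *\<^sub>R v) = norm (\<alpha> *\<^sub>R DSx (x, e) (v, 0))" by simp
    then have "(1 - \<alpha>) * norm v \<le> \<alpha> * (L_S * norm v)"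
      using b[of v] alpha by simp
    moreover have "\<alpha> * (1 + L_S) < 1" using L by (simp add: pos_less_divide_eq)
    ultimately have "v = 0"
    proof -
      assume a: "(1 - \<alpha>) * norm v \<le> \<alpha> * (L_S * norm v)" "\<alpha> * (1 + L_S) < 1"
      have "(1 - \<alpha> * (1 + L_S)) * norm v \<le> 0" using a(1) by (simp add: algebra_simps)
      with a(2) show "v = 0" by (simp add: mult_le_0_iff)
    qed
    with k hk show "h = 0" by (simp add: zero_prod_def)
  qed
  then show ?thesis using linear_injective_0[OF lin] by blast
qed

lemma inj_DT_interior:
  assumes lip: "L_S-lipschitz_on ({y. F y \<le> C} \<times> E) (Smap f r lam \<beta> \<mu>)" and L: "\<alpha> < 1 / (1 + L_S)"
    and x: "F x < C" "e \<in> E"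
  shows "inj (DT (x, e))"
proof (rule inj_DT[OF _ lipschitz_on_nonneg[OF lip] L])
  fix v
  have "isCont (\<lambda>s. F (x + s *\<^sub>R v)) 0"
    by (rule isCont_o2[OF _ F_isCont]) (intro continuous_intros)
  then have "((\<lambda>s. F (x + s *\<^sub>R v)) \<longlongrightarrow> F x) (at 0)" by (simp add: isCont_def)
  then have "\<forall>\<^sub>F s in at 0. F (x + s *\<^sub>R v) < C" using x(1) by (rule order_tendstoD)
  then have "\<forall>\<^sub>F s in at_right 0. F (x + s *\<^sub>R v) < C" by (simp add: eventually_at_split)
  then have "\<forall>\<^sub>F s in at_right 0. x + s *\<^sub>R v \<in> {y. F y \<le> C}" by eventually_elim simp
  with lip show "norm (DSx (x, e) (v, 0)) \<le> L_S * norm v"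
    using x by (intro DSx_directional_bound) auto
qed

text \<open>On the boundary of the level set the Lipschitz bound only controls the directions pointing
  into it, but these fill an open half-space and the bound is symmetric under \<open>v \<mapsto> - v\<close>.\<close>

lemma inj_DT_boundary:
  assumes lip: "L_S-lipschitz_on ({y. F y \<le> C} \<times> E) (Smap f r lam \<beta> \<mu>)" and L: "\<alpha> < 1 / (1 + L_S)"
    and e: "\<And>i. e $ i > 0" and x: "F x = FS x e" "FS x e = C" "e \<in> E" and g: "g x \<noteq> 0"
  shows "inj (DT (x, e))"
proof -
  \<comment> \<open>With vanishing weights the penalty part of the majorant is flat, so a decrease
    of \<open>f\<close> alone keeps \<open>x + k v\<close> in the level set.\<close>
  have neg: "norm (DSx (x, e) (v, 0)) \<le> L_S * norm v" if v: "g x \<bullet> v < 0" for v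
  proof (rule DSx_directional_bound[OF lip])
    have u0: "u x e i = 0" for i using weights_vanish[OF e x(1)] .
    obtain \<eta> where \<eta>: "\<eta> > 0" "\<And>k. 0 < k \<Longrightarrow> k < \<eta> \<Longrightarrow> f (x + (0 + k) *\<^sub>R v) < f (x + 0 *\<^sub>R v)"
      using DERIV_neg_dec_right[OF f_line_deriv[of x v 0]] v by auto
    have "x + k *\<^sub>R v \<in> {y. F y \<le> C}" if "0 < k" "k < \<eta>" for k
      using \<eta>(2)[OF that] FS_majorant[OF e, of x k v] F_le_FS[of "x + k *\<^sub>R v" e] x(2) by (simp add: u0)
    then show "\<forall>\<^sub>F s in at_right 0. x + s *\<^sub>R v \<in> {y. F y \<le> C}"
      using \<eta>(1) by (intro eventually_at_rightI[of 0 \<eta>]) auto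
  qed (use x in auto)
  interpret D: bounded_linear "DSx (x, e)" using strict_derivativeD(1)[OF Sx_strict] .
  \<comment> \<open>Tilting \<open>v\<close> by a small multiple of \<open>- g x\<close> moves the
    closed half-space into the open one; the bound passes to the limit.\<close>
  have nonpos: "norm (DSx (x, e) (v, 0)) \<le> L_S * norm v" if v: "g x \<bullet> v \<le> 0" for v
  proof (rule tendsto_le[OF trivial_limit_at_right_real])
    show "((\<lambda>s. L_S * norm (v - s *\<^sub>R g x)) \<longlongrightarrow> L_S * norm v) (at_right 0)"
      by (rule tendsto_eq_intros refl | simp)+
    show "((\<lambda>s. norm (DSx (x, e) (v - s *\<^sub>R g x, 0))) \<longlongrightarrow> norm (DSx (x, e) (v, 0))) (at_right 0)"
      by (rule tendsto_norm, rule D.tendsto) (rule tendsto_eq_intros refl | simp)+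
    have "\<forall>\<^sub>F s in at_right 0. (0::real) < s" by (rule eventually_at_right_less)
    then show "\<forall>\<^sub>F s in at_right 0. norm (DSx (x, e) (v - s *\<^sub>R g x, 0)) \<le> L_S * norm (v - s *\<^sub>R g x)"
    proof eventually_elim
      case (elim s)
      have "s * (g x \<bullet> g x) > 0" using elim g by simp
      then show ?case using v by (intro neg) (simp add: inner_diff_right)
    qed
  qed
  have "norm (DSx (x, e) (v, 0)) \<le> L_S * norm v" for v
  proof (cases "g x \<bullet> v \<le> 0")
    case False
    then have "norm (DSx (x, e) (- v, 0)) \<le> L_S * norm (- v)" by (intro nonpos) simp
    moreover have "DSx (x, e) (- v, 0) = - DSx (x, e) (v, 0)"
      using linear_neg[OF bounded_linear.linear[OF D.bounded_linear_axioms], of "(v, 0)"] by simp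
    ultimately show ?thesis by simp
  qed (rule nonpos)
  then show ?thesis by (rule inj_DT[OF _ lipschitz_on_nonneg[OF lip] L])
qed

lemma orbit_level:
  assumes e: "\<And>i. e $ i > 0"
    and L: "L-lipschitz_on {y. F y \<le> FS x e} g" and \<beta>: "\<beta> > \<alpha> * L / 2"
  shows "FS (fst ((T ^^ k) (x, e))) (snd ((T ^^ k) (x, e))) \<le> FS x e"
proof (induction k)
  case (Suc k)
  obtain y h where y: "(T ^^ k) (x, e) = (y, h)" by fastforce
  obtain y' h' where y': "T (y, h) = (y', h')" by fastforce
  have "h = c ^ k *\<^sub>R e" using snd_T_pow[of k "(x, e)"] y by simp
  then have "h $ i > 0" for i using e c_bounds by simp
  then have "FS y' h' \<le> FS y h"
    by (rule T_descent(1)) (use Suc y L \<beta> y' in auto)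
  then show ?case using Suc y y' by simp
qed simp

text \<open>The exceptional orbits start at critical points of \<open>f\<close> around which \<open>r\<close> is constant in every coordinate;
  there the Lipschitz bound gives no control over the derivative.\<close>

lemma orbit_dichotomy:
  assumes e: "\<And>i. e $ i > 0"
    and L: "L-lipschitz_on {y. F y \<le> FS x e} g" and \<beta>: "\<beta> > \<alpha> * L / 2"
    and lip: "L_S-lipschitz_on ({y. F y \<le> FS x e} \<times> cbox 0 e) (Smap f r lam \<beta> \<mu>)" and LS: "\<alpha> < 1 / (1 + L_S)"
  shows "(\<forall>k. (T ^^ k) (x, e) = (x, c ^ k *\<^sub>R e)) \<or> (\<forall>k. inj (DT ((T ^^ k) (x, e))))"
proof (cases "F x = FS x e \<and> g x = 0")
  case True
  have "(T ^^ k) (x, e) = (x, c ^ k *\<^sub>R e)" for k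
  proof (induction k)
    case (Suc k)
    let ?e = "c ^ k *\<^sub>R e"
    have pos: "?e $ i > 0" for i using e c_bounds by simp
    have "FS x ?e \<le> FS x e" using orbit_level[OF e L \<beta>, of k] Suc by simp
    then have "F x = FS x ?e" using True F_le_FS[of x ?e] by simp
    then have "u x ?e i = 0" for i using pos by (intro weights_vanish)
    then have "\<beta> * (Sx f r lam \<beta> x ?e $ i - x $ i) = 0" for i
      using Sx_optimality[OF pos, of x i] True by simp
    then have "Sx f r lam \<beta> x ?e = x" using beta by (simp add: vec_eq_iff)
    then show ?case using Suc by (simp add: T_eq)
  qed simp
  then show ?thesis by blast
next
  case False
  let ?x = "\<lambda>k. fst ((T ^^ k) (x, e))"
  have orb: "(T ^^ k) (x, e) = (?x k, c ^ k *\<^sub>R e)" for k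
    using snd_T_pow[of k "(x, e)"] by (simp add: prod_eq_iff)
  have pos: "(c ^ k *\<^sub>R e) $ i > 0" for i k using e c_bounds by simp
  have box: "c ^ k *\<^sub>R e \<in> cbox 0 e" for k
  proof -
    have "0 \<le> c ^ k * e $ i \<and> c ^ k * e $ i \<le> e $ i" for i
      using e[of i] c_bounds by (simp add: mult_left_le_one_le power_le_one less_imp_le)
    then show ?thesis by (simp add: mem_box_cart)
  qed
  \<comment> \<open>Once \<open>x\<close> has moved or \<open>F\<close> is below the initial level,
    the next iterate is strictly inside the level set. So only the starting point needs the boundary
    argument.\<close>
  have step: "F (?x (Suc k)) < FS x e" if "?x (Suc k) \<noteq> ?x k \<or> F (?x k) < FS x e" for k
  proof -
    have T: "T (?x k, c ^ k *\<^sub>R e) = (?x (Suc k), c ^ Suc k *\<^sub>R e)"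
      using orb[of k] orb[of "Suc k"] by simp
    have le: "FS (?x k) (c ^ k *\<^sub>R e) \<le> FS x e"
      using orbit_level[OF e L \<beta>, of k] snd_T_pow[of k "(x, e)"] by simp
    show ?thesis
    proof (cases "?x (Suc k) = ?x k")
      case False
      from T_descent(2)[OF pos le L \<beta> T False] le F_le_FS[of "?x (Suc k)" "c ^ Suc k *\<^sub>R e"]
      show ?thesis by linarith
    qed (use that in simp)
  qed
  have int: "inj (DT (?x k, c ^ k *\<^sub>R e))" if "F (?x k) < FS x e" for k
    using lip LS that box by (rule inj_DT_interior)
  have "inj (DT (x, e))" and start: "?x 1 \<noteq> ?x 0 \<or> F (?x 0) < FS x e"
  proof -
    consider "F x < FS x e" | "F x = FS x e" "g x \<noteq> 0" using False F_le_FS[of x e] by linarith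
    then have "inj (DT (x, e)) \<and> (?x 1 \<noteq> ?x 0 \<or> F (?x 0) < FS x e)"
    proof cases
      case 1
      then show ?thesis using int[of 0] by simp
    next
      case 2
      have "e \<in> cbox 0 e" using box[of 0] by simp
      with 2 have "inj (DT (x, e))" by (intro inj_DT_boundary[OF lip LS e]) auto
      moreover have "Sx f r lam \<beta> x e \<noteq> x"
      proof
        assume "Sx f r lam \<beta> x e = x"
        then have "g x $ i = 0" for i
          using Sx_optimality[OF e, of x i] weights_vanish[OF e 2(1)] by simp
        with 2(2) show False by (simp add: vec_eq_iff)
      qed
      ultimately show ?thesis using alpha by (simp add: T_eq)
    qed
    then show "inj (DT (x, e))" "?x 1 \<noteq> ?x 0 \<or> F (?x 0) < FS x e" by auto
  qed
  have later: "F (?x (Suc k)) < FS x e" for k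
  proof (induction k)
    case 0
    show ?case using step[of 0] start by simp
  next
    case (Suc k)
    then show ?case by (intro step) simp
  qed
  have "inj (DT ((T ^^ k) (x, e)))" for k
  proof (cases k)
    case 0
    then show ?thesis using \<open>inj (DT (x, e))\<close> by simp
  next
    case (Suc j)
    then show ?thesis using int[OF later[of j]] orb[of k] by metis
  qed
  then show ?thesis by blast
qed

end

section \<open>An expanding quadratic form at a strict saddle point\<close>

text \<open>Vectors in the kernels of \<open>M + \<theta> D\<close> for distinct \<open>\<theta>\<close> are \<open>D\<close>-orthogonal, so only finitely many
  \<open>\<theta>\<close> are bad.\<close>

lemma nonsingular_shift:
  fixes M :: "real ^ 'n::finite \<Rightarrow> real ^ 'n" and D :: "real ^ 'n"
  assumes sym: "\<And>a b. M a \<bullet> b = a \<bullet> M b" and D: "\<And>i. D $ i \<ge> 1" and \<theta>0: "\<theta>0 > 0"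
  obtains \<theta> where "0 < \<theta>" "\<theta> < \<theta>0" "\<And>v. M v + \<theta> *\<^sub>R (D * v) = 0 \<Longrightarrow> v = 0"
proof -
  define B where "B = {\<theta>. \<exists>v. v \<noteq> 0 \<and> M v + \<theta> *\<^sub>R (D * v) = 0}"
  define p where "p \<theta> = (SOME v. v \<noteq> 0 \<and> M v + \<theta> *\<^sub>R (D * v) = 0)" for \<theta>
  have p: "p \<theta> \<noteq> 0" "M (p \<theta>) = - \<theta> *\<^sub>R (D * p \<theta>)" if "\<theta> \<in> B" for \<theta>
  proof -
    have "p \<theta> \<noteq> 0 \<and> M (p \<theta>) + \<theta> *\<^sub>R (D * p \<theta>) = 0"
      unfolding p_def by (rule someI_ex) (use that in \<open>simp add: B_def\<close>)
    then show "p \<theta> \<noteq> 0" "M (p \<theta>) = - \<theta> *\<^sub>R (D * p \<theta>)" by (auto simp: eq_neg_iff_add_eq_0)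
  qed
  \<comment> \<open>The square root of \<open>D\<close> turns orthogonality with respect to
    \<open>D\<close> into ordinary orthogonality, where the finiteness of orthogonal families
    applies.\<close>
  define R where "R v = (\<chi> i. sqrt (D $ i) * v $ i)" for v :: "real ^ 'n"
  have R: "R a \<bullet> R b = (D * a) \<bullet> b" for a b
  proof -
    have *: "sqrt (D $ i) * a $ i * (sqrt (D $ i) * b $ i) = D $ i * a $ i * b $ i" for i
    proof -
      have "sqrt (D $ i) * sqrt (D $ i) = D $ i" using D[of i] by simp
      then show ?thesis by (metis mult.assoc mult.commute)
    qed
    show ?thesis
      by (simp only: R_def inner_vec_def vec_lambda_beta inner_real_def vector_mult_component *)
  qed
  have Dsym: "(D * a) \<bullet> b = a \<bullet> (D * b)" for a b
    by (simp add: inner_vec_def mult_ac)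
  have orth: "R (p s) \<bullet> R (p t) = 0" if "s \<in> B" "t \<in> B" "s \<noteq> t" for s t
  proof -
    have "M (p s) \<bullet> p t = p s \<bullet> M (p t)" by (rule sym)
    then have "s * ((D * p s) \<bullet> p t) = t * ((D * p s) \<bullet> p t)"
      using p(2)[OF that(1)] p(2)[OF that(2)] by (simp add: Dsym)
    then show ?thesis using that(3) by (simp add: R)
  qed
  have R0: "R (p s) \<noteq> 0" if "s \<in> B" for s
  proof
    assume "R (p s) = 0"
    then have "p s $ i = 0" for i
      using D[of i] by (auto simp: R_def vec_eq_iff dest: spec[of _ i])
    then have "p s = 0" by (simp add: vec_eq_iff)
    with p(1)[OF that] show False by simp
  qed
  have "inj_on (\<lambda>s. R (p s)) B"
    using orth R0 by (intro inj_onI) (metis inner_eq_zero_iff)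
  moreover have "finite ((\<lambda>s. R (p s)) ` B)"
    using orth by (intro pairwise_orthogonal_imp_finite) (auto simp: pairwise_def orthogonal_def)
  ultimately have "finite B" by (rule finite_imageD[rotated])
  moreover have "infinite {0<..<\<theta>0}" using \<theta>0 by simp
  ultimately have "\<not> {0<..<\<theta>0} \<subseteq> B" by (meson finite_subset)
  then obtain \<theta> where "\<theta> \<in> {0<..<\<theta>0}" "\<theta> \<notin> B" by blast
  then show ?thesis using that unfolding B_def by auto
qed

text \<open>Let N be \<open>M\<close> divided by \<open>D\<close>; it is self-adjoint for the inner
  product weighted by \<open>D\<close>. On an eigenvector with eigenvalue s the step multiplies by 1
  - \<alpha> s \<ge> 0, and \<Phi> has the sign of s + \<theta>. The multiplier exceeds
  \<open>g\<close> exactly when s < - \<theta>, that is, when \<Phi> is negative; so in either case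
  \<Phi> drops below \<open>g\<^sup>2\<close> times its old value, with equality only in the kernel
  of N + \<theta>. The proof does this without diagonalizing, by writing the step as
  \<open>g *\<^sub>R p - \<alpha> *\<^sub>R z\<close> with \<open>z = y p\<close>.\<close>

lemma gradient_step_quadratic_form:
  fixes M :: "real ^ 'n::finite \<Rightarrow> real ^ 'n" and D :: "real ^ 'n"
  assumes lin: "linear M" and sym: "\<And>a b. M a \<bullet> b = a \<bullet> M b" and D: "\<And>i. D $ i \<ge> 1"
    and M: "\<And>v. \<alpha> * (M v \<bullet> v) \<le> v \<bullet> v" and \<alpha>: "\<alpha> > 0" and \<theta>: "\<theta> > 0"
  defines "\<Phi> \<equiv> \<lambda>a b. M a \<bullet> b + \<theta> * ((D * a) \<bullet> b)" and "g \<equiv> 1 + \<alpha> * \<theta>"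
    and "y \<equiv> \<lambda>p. (\<chi> i. M p $ i / D $ i) + \<theta> *\<^sub>R p"
  shows "\<Phi> (p - \<alpha> *\<^sub>R (\<chi> i. M p $ i / D $ i)) (p - \<alpha> *\<^sub>R (\<chi> i. M p $ i / D $ i))
    \<le> g\<^sup>2 * \<Phi> p p - g * \<alpha> * (norm (y p))\<^sup>2"
proof -
  define z where "z = y p"
  have Dz: "D * z = M p + \<theta> *\<^sub>R (D * p)"
  proof -
    have "D $ i * (M p $ i / D $ i + \<theta> * p $ i) = M p $ i + \<theta> * (D $ i * p $ i)" for i
      using D[of i] by (simp add: field_simps)
    then show ?thesis by (simp add: z_def y_def vec_eq_iff)
  qed
  have Dsym: "(D * a) \<bullet> b = a \<bullet> (D * b)" for a b
    by (simp add: inner_vec_def mult_ac)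
  have step: "p - \<alpha> *\<^sub>R (\<chi> i. M p $ i / D $ i) = g *\<^sub>R p - \<alpha> *\<^sub>R z"
    by (simp add: z_def y_def g_def algebra_simps)
  have Dle: "(norm z)\<^sup>2 \<le> (D * z) \<bullet> z"
  proof -
    have "z $ i * z $ i \<le> D $ i * z $ i * z $ i" for i
      using mult_right_mono[OF D[of i], of "z $ i * z $ i"] by (simp add: mult.assoc)
    then show ?thesis by (auto simp: power2_norm_eq_inner inner_vec_def intro!: sum_mono)
  qed
  have pz: "\<Phi> p z = (D * z) \<bullet> z" by (simp add: Dz \<Phi>_def inner_add_left)
  have "M z \<bullet> p = M p \<bullet> z" "(D * z) \<bullet> p = (D * p) \<bullet> z"
    by (metis sym inner_commute, metis Dsym inner_commute)
  then have zp: "\<Phi> z p = \<Phi> p z" by (simp add: \<Phi>_def)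
  have "\<Phi> (g *\<^sub>R p - \<alpha> *\<^sub>R z) (g *\<^sub>R p - \<alpha> *\<^sub>R z) = g\<^sup>2 * \<Phi> p p - g * \<alpha> * \<Phi> p z - g * \<alpha> * \<Phi> z p + \<alpha>\<^sup>2 * \<Phi> z z"
  proof -
    have D1: "D * (a - b) = D * a - D * b" for a b by (simp add: vec_eq_iff algebra_simps)
    have D2: "D * (k *\<^sub>R a) = k *\<^sub>R (D * a)" for a k by (simp add: vec_eq_iff)
    show ?thesis
      unfolding \<Phi>_def D1 D2 linear_diff[OF lin] linear_cmul[OF lin]
      by (simp add: inner_diff_left inner_diff_right algebra_simps power2_eq_square)
  qed
  also have "\<dots> = g\<^sup>2 * \<Phi> p p - 2 * g * \<alpha> * ((D * z) \<bullet> z) + \<alpha> * (\<alpha> * (M z \<bullet> z)) + \<alpha> * (\<alpha> * \<theta> * ((D * z) \<bullet> z))"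
    unfolding zp pz by (simp add: \<Phi>_def algebra_simps power2_eq_square)
  \<comment> \<open>The step size restriction enters here, as \<alpha> M z . z \<le> z . z \<le> D z
    . z; it is the statement 1 - \<alpha> s \<ge> 0 for the eigenvalues.\<close>
  also have "\<alpha> * (\<alpha> * (M z \<bullet> z)) \<le> \<alpha> * ((D * z) \<bullet> z)"
    using M[of z] Dle \<alpha> by (intro mult_left_mono) (auto simp: power2_norm_eq_inner)
  also have "g\<^sup>2 * \<Phi> p p - 2 * g * \<alpha> * ((D * z) \<bullet> z) + \<alpha> * ((D * z) \<bullet> z) + \<alpha> * (\<alpha> * \<theta> * ((D * z) \<bullet> z))
      = g\<^sup>2 * \<Phi> p p - g * \<alpha> * ((D * z) \<bullet> z)"
    by (simp add: g_def algebra_simps)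
  also have "\<dots> \<le> g\<^sup>2 * \<Phi> p p - g * \<alpha> * (norm z)\<^sup>2"
    using Dle \<alpha> \<theta> by (intro diff_left_mono mult_left_mono) (auto simp: g_def)
  finally show ?thesis by (simp add: step z_def)
qed

text \<open>On the coordinates in \<open>I\<close> the form is \<open>- (M + \<theta> D)\<close>. The coordinates outside \<open>I\<close> and the smoothing
  parameters are contracted and enter with a large negative weight, which absorbs the coupling \<open>C\<close>.\<close>

lemma expanding_form:
  fixes M C :: "real ^ 'n::finite \<Rightarrow> real ^ 'n" and D :: "real ^ 'n" and I :: "'n set"
    and A :: "(real ^ 'n) \<times> (real ^ 'n) \<Rightarrow> (real ^ 'n) \<times> (real ^ 'n)"
  defines "P \<equiv> \<lambda>v :: real ^ 'n. \<chi> i. if i \<in> I then v $ i else 0"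
  assumes lin: "linear M" and sym: "\<And>a b. M a \<bullet> b = a \<bullet> M b" and linC: "linear C"
    and supp: "\<And>v i. i \<notin> I \<Longrightarrow> M v $ i = 0" "\<And>v i. i \<notin> I \<Longrightarrow> C v $ i = 0"
    and D: "\<And>i. D $ i \<ge> 1" and M: "\<And>v. \<alpha> * (M v \<bullet> v) \<le> v \<bullet> v"
    and \<alpha>: "0 < \<alpha>" "\<alpha> < 1" and c: "0 < c" "c < 1"
    and neg: "P dneg = dneg" "M dneg \<bullet> dneg < 0"
    and A: "\<And>v e. A (v, e) = (P v - \<alpha> *\<^sub>R (\<chi> i. M (P v) $ i / D $ i) + C (v - P v)
        + (1 - \<alpha>) *\<^sub>R (v - P v), c *\<^sub>R e)"
  shows "\<exists>b g d v. bounded_bilinear b \<and> g > (1::real) \<and> d > (0::real) \<and>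
    (\<forall>h. b (A h) (A h) \<ge> g * b h h + d * (norm h)\<^sup>2) \<and> b v v > (0::real)"
proof -
  \<comment> \<open>Below this threshold the shifted form is still negative at \<open>dneg\<close>.
    The summand 1 makes the denominator positive at once.\<close>
  define \<theta>0 where "\<theta>0 = - (M dneg \<bullet> dneg) / ((D * dneg) \<bullet> dneg + 1)"
  have Ddneg: "(D * dneg) \<bullet> dneg \<ge> 0"
  proof -
    have "D $ i * dneg $ i * dneg $ i \<ge> 0" for i
      using mult_nonneg_nonneg[of "D $ i" "dneg $ i * dneg $ i"] D[of i] by (simp add: mult.assoc)
    then show ?thesis by (auto simp: inner_vec_def intro!: sum_nonneg)
  qed
  then have "\<theta>0 > 0" using neg by (simp add: \<theta>0_def divide_neg_pos)
  then obtain \<theta> where \<theta>: "0 < \<theta>" "\<theta> < \<theta>0" "\<And>v. M v + \<theta> *\<^sub>R (D * v) = 0 \<Longrightarrow> v = 0"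
    using nonsingular_shift[OF sym D] by blast
  define \<Phi> where "\<Phi> a b = M a \<bullet> b + \<theta> * ((D * a) \<bullet> b)" for a b
  define g where "g = 1 + \<alpha> * \<theta>"
  have g: "g > 1" using \<alpha> \<theta> by (simp add: g_def)
  have \<Phi>dneg: "\<Phi> dneg dneg < 0"
  proof -
    have "\<theta> * ((D * dneg) \<bullet> dneg + 1) < - (M dneg \<bullet> dneg)"
      using \<theta>(2) Ddneg unfolding \<theta>0_def by (subst (asm) pos_less_divide_eq) auto
    then show ?thesis using \<theta>(1) by (simp add: \<Phi>_def algebra_simps)
  qed
  have D1: "D * (a + b) = D * a + D * b" and D2: "D * (k *\<^sub>R a) = k *\<^sub>R (D * a)" for a b k
    by (simp_all add: vec_eq_iff algebra_simps)
  have Dsym: "(D * a) \<bullet> b = a \<bullet> (D * b)" for a b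
    by (simp add: inner_vec_def mult_ac)
  have \<Phi>_sym: "\<Phi> a b = \<Phi> b a" for a b
  proof -
    have "M a \<bullet> b = M b \<bullet> a" "(D * a) \<bullet> b = (D * b) \<bullet> a"
      by (metis sym inner_commute, metis Dsym inner_commute)
    then show ?thesis by (simp add: \<Phi>_def)
  qed
  have \<Phi>_add: "\<Phi> (a + b) w = \<Phi> a w + \<Phi> b w" and \<Phi>_scale: "\<Phi> (k *\<^sub>R a) w = k * \<Phi> a w" for a b w k
    unfolding \<Phi>_def D1 D2 linear_add[OF lin] linear_cmul[OF lin]
    by (simp_all add: inner_add_left algebra_simps)
  have \<Phi>_add_right: "\<Phi> w (a + b) = \<Phi> w a + \<Phi> w b" for a b w
    using \<Phi>_add[of a b w] by (simp only: \<Phi>_sym[of _ w])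
  have "linear (\<lambda>a. \<Phi> a w)" for w by (rule linearI) (simp_all add: \<Phi>_add \<Phi>_scale)
  moreover have "\<Phi> w = (\<lambda>a. \<Phi> a w)" for w using \<Phi>_sym by blast
  ultimately have bil: "bilinear \<Phi>" unfolding bilinear_def by metis
  obtain \<kappa> where \<kappa>: "\<kappa> > 0" "\<And>a b. norm (\<Phi> a b) \<le> \<kappa> * norm a * norm b"
    using bilinear_bounded_pos[OF bil] by blast
  \<comment> \<open>The choice of \<open>\<theta>\<close> makes \<open>y\<close> injective, which
    turns the loss |y p|^2 of the gradient step into a multiple of |p|^2.\<close>
  define y where "y p = (\<chi> i. M p $ i / D $ i) + \<theta> *\<^sub>R p" for p
  have D0: "D $ i \<noteq> 0" for i using D[of i] by auto
  have "linear (\<lambda>v :: real ^ 'n. \<chi> i. v $ i / D $ i)"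
    by (rule linearI) (simp_all add: vec_eq_iff add_divide_distrib)
  from linear_compose[OF lin this] have linN: "linear (\<lambda>v. \<chi> i. M v $ i / D $ i)"
    by (simp add: o_def)
  have liny: "linear y"
    using linear_compose_add[OF linN linear_compose_scale_right[OF linear_ident, of \<theta>]]
    by (simp add: y_def [abs_def])
  have "inj y"
  proof -
    have "v = 0" if "y v = 0" for v
    proof (rule \<theta>(3))
      have "M v $ i + \<theta> * (D $ i * v $ i) = 0" for i
      proof -
        have "y v $ i = 0" using that by simp
        then show ?thesis using D0[of i] by (simp add: y_def field_simps)
      qed
      then show "M v + \<theta> *\<^sub>R (D * v) = 0" by (simp add: vec_eq_iff)
    qed
    then show ?thesis using linear_injective_0[OF liny] by blast
  qed
  then obtain \<delta> where \<delta>: "\<delta> > 0" "\<And>v. \<delta> * norm v \<le> norm (y v)"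
    using linear_inj_bounded_below_pos[OF liny] by (metis mult.commute)
  define B where "B p = p - \<alpha> *\<^sub>R (\<chi> i. M p $ i / D $ i)" for p
  have linB: "linear B"
    using linear_compose_sub[OF linear_ident linear_compose_scale_right[OF linN, of \<alpha>]]
    by (simp add: B_def [abs_def])
  define a where "a = g * \<alpha> * \<delta>\<^sup>2"
  have a: "a > 0" using g \<alpha> \<delta> by (simp add: a_def)
  have \<Phi>B: "\<Phi> (B p) (B p) \<le> g\<^sup>2 * \<Phi> p p - a * (norm p)\<^sup>2" for p
  proof -
    have "\<Phi> (B p) (B p) \<le> g\<^sup>2 * \<Phi> p p - g * \<alpha> * (norm (y p))\<^sup>2"
      using gradient_step_quadratic_form[OF lin sym D M \<alpha>(1) \<theta>(1), of p]
      by (simp add: \<Phi>_def B_def g_def y_def)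
    moreover have "(\<delta> * norm p)\<^sup>2 \<le> (norm (y p))\<^sup>2" using \<delta> by (intro power_mono) auto
    then have "g * \<alpha> * (\<delta> * norm p)\<^sup>2 \<le> g * \<alpha> * (norm (y p))\<^sup>2"
      using g \<alpha> by (intro mult_left_mono) auto
    ultimately show ?thesis by (simp add: a_def power_mult_distrib mult.assoc)
  qed
  obtain k1 where k1: "k1 > 0" "\<And>v. norm (B v) \<le> k1 * norm v" using linear_bounded_pos[OF linB] by blast
  obtain k2 where k2: "k2 > 0" "\<And>v. norm (C v) \<le> k2 * norm v" using linear_bounded_pos[OF linC] by blast
  define k3 where "k3 = \<kappa> * k1 * k2"
  \<comment> \<open>Young's inequality: the mixed term is split so that half of the gain
    \<open>a\<close> remains for \<open>p\<close>, the rest being charged to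
    \<open>q\<close>.\<close>
  define k4 where "k4 = 2 * k3\<^sup>2 / a + \<kappa> * k2\<^sup>2"
  have k3: "k3 > 0" using \<kappa> k1 k2 by (simp add: k3_def)
  have k4: "k4 > 0" using \<kappa> k2 a by (auto simp: k4_def intro!: add_nonneg_pos)
  have \<Phi>step: "\<Phi> (B p + C q) (B p + C q) \<le> g\<^sup>2 * \<Phi> p p - a / 2 * (norm p)\<^sup>2 + k4 * (norm q)\<^sup>2" for p q
  proof -
    have "\<Phi> (B p + C q) (B p + C q) = \<Phi> (B p) (B p) + 2 * \<Phi> (B p) (C q) + \<Phi> (C q) (C q)"
      by (simp add: \<Phi>_add \<Phi>_add_right \<Phi>_sym[of "C q" "B p"])
    moreover have "\<Phi> (B p) (C q) \<le> k3 * (norm p * norm q)"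
    proof -
      have "\<Phi> (B p) (C q) \<le> \<kappa> * norm (B p) * norm (C q)" using \<kappa>(2)[of "B p" "C q"] by simp
      also have "\<dots> \<le> \<kappa> * (k1 * norm p) * (k2 * norm q)"
        using \<kappa>(1) k1 k2 by (intro mult_mono) auto
      finally show ?thesis by (simp add: k3_def mult_ac)
    qed
    moreover have "\<Phi> (C q) (C q) \<le> \<kappa> * k2\<^sup>2 * (norm q)\<^sup>2"
    proof -
      have "\<Phi> (C q) (C q) \<le> \<kappa> * norm (C q) * norm (C q)" using \<kappa>(2)[of "C q" "C q"] by simp
      also have "\<dots> \<le> \<kappa> * (k2 * norm q) * (k2 * norm q)"
        using \<kappa>(1) k2 by (intro mult_mono) auto
      finally show ?thesis by (simp add: power2_eq_square mult_ac)
    qed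
    moreover have "2 * (k3 * (norm p * norm q)) \<le> a / 2 * (norm p)\<^sup>2 + 2 * k3\<^sup>2 / a * (norm q)\<^sup>2"
    proof -
      have "0 \<le> (a * norm p - 2 * k3 * norm q)\<^sup>2 / (2 * a)" using a by simp
      also have "\<dots> = a / 2 * (norm p)\<^sup>2 + 2 * k3\<^sup>2 / a * (norm q)\<^sup>2 - 2 * (k3 * (norm p * norm q))"
        using a by (simp add: field_simps power2_eq_square)
      finally show ?thesis by simp
    qed
    ultimately show ?thesis using \<Phi>B[of p] by (simp add: k4_def algebra_simps)
  qed
  \<comment> \<open>The contraction of \<open>q\<close> by \<open>1 - \<alpha>\<close> has to pay
    for \<open>k4\<close> times |q|^2 and still leave |q|^2 as a gain.\<close>
  define K where "K = (k4 + 1) / (1 - (1 - \<alpha>)\<^sup>2)"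
  have sq: "(1 - \<alpha>)\<^sup>2 < 1" using \<alpha> by (simp add: power_less_one_iff abs_square_less_1)
  have c2: "c\<^sup>2 < 1" using c by (simp add: power_less_one_iff)
  have K: "K > 0" "K * (1 - (1 - \<alpha>)\<^sup>2) = k4 + 1" using sq k4 by (simp_all add: K_def)
  define bf where "bf z z' = - \<Phi> (P (fst z)) (P (fst z'))
      - K * ((fst z - P (fst z)) \<bullet> (fst z' - P (fst z')) + snd z \<bullet> snd z')" for z z' :: "(real ^ 'n) \<times> (real ^ 'n)"
  have linP: "linear P" by (rule linearI) (simp_all add: P_def vec_eq_iff)
  have PP: "P (P v) = P v" for v by (simp add: P_def vec_eq_iff)
  have bf_sym: "bf z z' = bf z' z" for z z' by (simp add: bf_def \<Phi>_sym inner_commute)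
  have bf_add: "bf (z + z') w = bf z w + bf z' w" and bf_scale: "bf (k *\<^sub>R z) w = k * bf z w" for z z' w k
    by (simp_all add: bf_def linear_add[OF linP] linear_cmul[OF linP] \<Phi>_add \<Phi>_scale inner_add_left
         inner_diff_left algebra_simps)
  have "linear (\<lambda>z. bf z w)" for w by (rule linearI) (simp_all add: bf_add bf_scale)
  moreover have "bf w = (\<lambda>z. bf z w)" for w using bf_sym by blast
  ultimately have "bilinear bf" unfolding bilinear_def by metis
  then have bb: "bounded_bilinear bf" by (simp add: bilinear_conv_bounded_bilinear)
  define d where "d = min (a / 2) (min 1 (K * (1 - c\<^sup>2)))"
  have "K * (1 - c\<^sup>2) > 0" using K c2 by simp
  then have d: "d > 0" "d \<le> a / 2" "d \<le> 1" "d \<le> K * (1 - c\<^sup>2)" using a by (auto simp: d_def)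
  have g2: "g\<^sup>2 > 1" using g by (simp add: power2_gt_1_iff)
  have expand: "bf (A h) (A h) \<ge> g\<^sup>2 * bf h h + d * (norm h)\<^sup>2" for h
  proof -
    obtain v e where h: "h = (v, e)" by fastforce
    define p where "p = P v"
    define q where "q = v - P v"
    have Pq: "P q = 0" by (simp add: q_def linear_diff[OF linP] PP)
    have Pp: "P p = p" by (simp add: p_def PP)
    have PB: "P (B p + C q) = B p + C q"
      using supp Pp by (auto simp: P_def B_def vec_eq_iff split: if_splits)
    have Ah: "A h = (B p + C q + (1 - \<alpha>) *\<^sub>R q, c *\<^sub>R e)" by (simp add: h A p_def q_def B_def)
    have PA: "P (fst (A h)) = B p + C q"
      by (simp add: Ah linear_add[OF linP, of "B p + C q"] PB linear_cmul[OF linP] Pq)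
    have "bf (A h) (A h) = - \<Phi> (B p + C q) (B p + C q) - K * ((1 - \<alpha>)\<^sup>2 * (norm q)\<^sup>2 + c\<^sup>2 * (norm e)\<^sup>2)"
      unfolding bf_def PA by (simp add: Ah power2_norm_eq_inner power2_eq_square[of "1 - \<alpha>"] power2_eq_square[of c] mult.assoc)
    then have 1: "bf (A h) (A h) \<ge> - (g\<^sup>2 * \<Phi> p p) + a / 2 * (norm p)\<^sup>2 - k4 * (norm q)\<^sup>2
        - K * ((1 - \<alpha>)\<^sup>2 * (norm q)\<^sup>2 + c\<^sup>2 * (norm e)\<^sup>2)"
      using \<Phi>step[of p q] by linarith
    have bfh: "bf h h = - \<Phi> p p - K * ((norm q)\<^sup>2 + (norm e)\<^sup>2)"
      by (simp add: bf_def h p_def q_def power2_norm_eq_inner)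
    have orth: "p \<bullet> q = 0"
      by (simp add: p_def q_def P_def inner_vec_def) (intro sum.neutral ballI, simp)
    have "v = p + q" by (simp add: p_def q_def)
    then have "(norm v)\<^sup>2 = (norm p)\<^sup>2 + (norm q)\<^sup>2"
      using orth by (simp add: power2_norm_eq_inner inner_add_left inner_add_right inner_commute)
    then have nh: "(norm h)\<^sup>2 = (norm p)\<^sup>2 + (norm q)\<^sup>2 + (norm e)\<^sup>2" by (simp add: h norm_Pair)
    have t1: "d * (norm p)\<^sup>2 \<le> a / 2 * (norm p)\<^sup>2" using d(2) by (rule mult_right_mono) simp
    have t2: "d * (norm q)\<^sup>2 \<le> K * (1 - (1 - \<alpha>)\<^sup>2) * (norm q)\<^sup>2 - k4 * (norm q)\<^sup>2"
      using mult_right_mono[OF d(3), of "(norm q)\<^sup>2"] unfolding K(2) by (simp add: distrib_right)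
    have t3: "d * (norm e)\<^sup>2 \<le> K * (1 - c\<^sup>2) * (norm e)\<^sup>2" using d(4) by (rule mult_right_mono) simp
    \<comment> \<open>The contracted block enters \<open>bf\<close> with a negative sign, so scaling
      it by \<open>g\<^sup>2 > 1\<close> only weakens the required inequality.\<close>
    have t4: "K * ((norm q)\<^sup>2 + (norm e)\<^sup>2) \<le> g\<^sup>2 * (K * ((norm q)\<^sup>2 + (norm e)\<^sup>2))"
      using mult_right_mono[of 1 "g\<^sup>2" "K * ((norm q)\<^sup>2 + (norm e)\<^sup>2)"] g2 K(1) by simp
    show ?thesis using 1 t1 t2 t3 t4 unfolding bfh nh by (simp add: algebra_simps)
  qed
  have "bf (dneg, 0) (dneg, 0) > 0" using \<Phi>dneg by (simp add: bf_def neg)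
  with bb g2 d(1) expand show ?thesis by blast
qed

section \<open>Strict saddle points\<close>

lemma symmetric_matrix_inner:
  fixes A :: "real ^ 'n::finite ^ 'n"
  assumes "\<And>i j. A $ i $ j = A $ j $ i"
  shows "(A *v a) \<bullet> b = a \<bullet> (A *v b)"
proof -
  have "transpose A = A" using assms by (simp add: transpose_def vec_eq_iff)
  then show ?thesis by (metis dot_lmul_matrix transpose_matrix_vector)
qed

context dirl2_setting
begin

section \<open>The Hessian of the objective in the nonzero coordinates\<close>

lemma partial_objective:
  assumes y: "y $ j \<noteq> 0"
  shows "partial j F y = g y $ j + lam * (sgn (y $ j) * deriv r \<bar>y $ j\<bar>)"
proof -
  have f: "((\<lambda>t. f (y + t *\<^sub>R axis j 1)) has_real_derivative g y $ j) (at 0)"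
    using f_line_deriv[of y "axis j 1" 0] by (simp add: inner_axis)
  have "((\<lambda>t. r \<bar>y $ j + t\<bar>) has_real_derivative (deriv r \<bar>y $ j + 0\<bar> * (sgn (y $ j + 0) * 1))) (at 0)"
  proof (rule DERIV_chain2[where f = r and g = "\<lambda>t. \<bar>y $ j + t\<bar>"])
    show "(r has_real_derivative deriv r \<bar>y $ j + 0\<bar>) (at \<bar>y $ j + 0\<bar>)" using y by (intro r_deriv) simp
    have "(norm has_derivative (\<lambda>h. h \<bullet> sgn (y $ j + 0))) (at (y $ j + 0))"
      using y by (intro has_derivative_norm) simp
    then have abs: "(abs has_real_derivative sgn (y $ j + 0)) (at (y $ j + 0))"
      unfolding real_norm_def [abs_def] has_field_derivative_def by (simp add: mult_commute_abs)
    show "((\<lambda>t. \<bar>y $ j + t\<bar>) has_real_derivative sgn (y $ j + 0) * 1) (at 0)"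
      by (rule DERIV_chain2[where f = abs and g = "\<lambda>t. y $ j + t", OF abs])
         (auto intro!: derivative_eq_intros)
  qed
  moreover have "(\<Sum>i\<in>UNIV. r \<bar>(y + t *\<^sub>R axis j 1) $ i\<bar>) = r \<bar>y $ j + t\<bar> + (\<Sum>i\<in>UNIV - {j}. r \<bar>y $ i\<bar>)" for t
    by (subst sum.remove[of UNIV j]) (auto simp: axis_def intro!: sum.cong)
  ultimately have "((\<lambda>t. \<Sum>i\<in>UNIV. r \<bar>(y + t *\<^sub>R axis j 1) $ i\<bar>) has_real_derivative (sgn (y $ j) * deriv r \<bar>y $ j\<bar>)) (at 0)"
    by (auto intro!: derivative_eq_intros simp: mult.commute)
  from DERIV_add[OF f DERIV_cmult[OF this, of lam]]
  show ?thesis unfolding partial_def objective_def by (rule DERIV_imp_deriv)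
qed

lemma H_entry_sym: "H x $ i $ j = H x $ j $ i"
  using H_symmetric[of x "axis i 1" "axis j 1"]
  by (simp add: inner_axis matrix_vector_mult_basis column_def)

lemma hessian_entry:
  assumes i: "x $ i \<noteq> 0" and j: "x $ j \<noteq> 0"
  shows "partial i (partial j F) x = H x $ i $ j + (if i = j then lam * deriv (deriv r) \<bar>x $ i\<bar> else 0)"
proof -
  \<comment> \<open>A Kronecker delta, treating i = j and i \<noteq> j together. Near t = 0
    coordinate j keeps its sign, so its absolute value becomes an affine function of t.\<close>
  define s where "s = (if i = j then 1 else 0 :: real)"
  have ax: "(x + t *\<^sub>R axis i 1) $ j = x $ j + s * t" for t by (auto simp: axis_def s_def)
  have eq: "\<forall>\<^sub>F t in nhds 0. partial j F (x + t *\<^sub>R axis i 1) =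
      g (x + t *\<^sub>R axis i 1) $ j + lam * (sgn (x $ j) * deriv r (sgn (x $ j) * (x $ j + s * t)))"
  proof -
    have "\<forall>\<^sub>F t in nhds 0. sgn (x $ j) * (x $ j + s * t) > 0"
    proof -
      have "isCont (\<lambda>t. sgn (x $ j) * (x $ j + s * t)) 0" by (intro continuous_intros)
      then have "((\<lambda>t. sgn (x $ j) * (x $ j + s * t)) \<longlongrightarrow> sgn (x $ j) * (x $ j + s * 0)) (nhds 0)"
        using tendsto_at_iff_tendsto_nhds[of "\<lambda>t. sgn (x $ j) * (x $ j + s * t)" 0] by (simp add: isCont_def)
      then show ?thesis by (rule order_tendstoD) (use j in \<open>auto simp: sgn_if\<close>)
    qed
    then show ?thesis
    proof eventually_elim
      case (elim t)
      then have a: "sgn (x $ j + s * t) = sgn (x $ j)" "\<bar>x $ j + s * t\<bar> = sgn (x $ j) * (x $ j + s * t)"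
        by (auto simp: sgn_if split: if_splits)
      have "x $ j + s * t \<noteq> 0" using elim by auto
      then have "(x + t *\<^sub>R axis i 1) $ j \<noteq> 0" unfolding ax .
      from partial_objective[OF this] show ?case unfolding ax a .
    qed
  qed
  have "((\<lambda>t. x + t *\<^sub>R axis i 1) has_derivative (\<lambda>t. t *\<^sub>R axis i 1)) (at 0)"
    by (auto intro!: derivative_eq_intros)
  then have "((\<lambda>t. g (x + t *\<^sub>R axis i 1)) has_derivative (\<lambda>t. H (x + 0 *\<^sub>R axis i 1) *v (t *\<^sub>R axis i 1))) (at 0)"
    by (rule has_derivative_compose) (rule grad_deriv)
  then have "((\<lambda>t. g (x + t *\<^sub>R axis i 1) $ j) has_derivative (\<lambda>t. (H x *v (t *\<^sub>R axis i 1)) $ j)) (at 0)"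
    by (intro bounded_linear.has_derivative[OF bounded_linear_vec_nth]) simp
  moreover have "(H x *v (t *\<^sub>R axis i 1)) $ j = H x $ i $ j * t" for t
    by (simp add: matrix_vector_mult_scaleR matrix_vector_mult_basis column_def H_entry_sym[of x i])
  ultimately have 1: "((\<lambda>t. g (x + t *\<^sub>R axis i 1) $ j) has_real_derivative H x $ i $ j) (at 0)"
    by (simp add: has_field_derivative_def)
  have 2: "((\<lambda>t. deriv r (sgn (x $ j) * (x $ j + s * t))) has_real_derivative
      deriv (deriv r) (sgn (x $ j) * (x $ j + s * 0)) * (sgn (x $ j) * s)) (at 0)"
  proof (rule DERIV_chain2[where f = "deriv r"])
    show "(deriv r has_real_derivative deriv (deriv r) (sgn (x $ j) * (x $ j + s * 0))) (at (sgn (x $ j) * (x $ j + s * 0)))"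
      using j by (intro r_deriv2) (simp add: sgn_if)
    show "((\<lambda>t. sgn (x $ j) * (x $ j + s * t)) has_real_derivative sgn (x $ j) * s) (at 0)"
      by (auto intro!: derivative_eq_intros)
  qed
  have "((\<lambda>t. g (x + t *\<^sub>R axis i 1) $ j + lam * (sgn (x $ j) * deriv r (sgn (x $ j) * (x $ j + s * t)))) has_real_derivative
     H x $ i $ j + lam * (sgn (x $ j) * (deriv (deriv r) (sgn (x $ j) * (x $ j + s * 0)) * (sgn (x $ j) * s)))) (at 0)"
    by (intro DERIV_add 1 DERIV_cmult 2)
  then have "((\<lambda>t. partial j F (x + t *\<^sub>R axis i 1)) has_real_derivative
     H x $ i $ j + lam * (sgn (x $ j) * (deriv (deriv r) (sgn (x $ j) * (x $ j + s * 0)) * (sgn (x $ j) * s)))) (at 0)"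
    by (subst DERIV_cong_ev[OF refl eq refl])
  then have "partial i (partial j F) x =
     H x $ i $ j + lam * (sgn (x $ j) * (deriv (deriv r) (sgn (x $ j) * (x $ j + s * 0)) * (sgn (x $ j) * s)))"
    unfolding partial_def[of i] by (rule DERIV_imp_deriv)
  also have "lam * (sgn (x $ j) * (deriv (deriv r) (sgn (x $ j) * (x $ j + s * 0)) * (sgn (x $ j) * s)))
      = (if i = j then lam * deriv (deriv r) \<bar>x $ i\<bar> else 0)"
    using j by (auto simp: s_def sgn_if)
  finally show ?thesis .
qed

abbreviation "hess \<equiv> hessian_nz f r lam"

lemma hess_sym: "hess x $ i $ j = hess x $ j $ i"
  by (auto simp: hessian_nz_def nz_coords_def hessian_entry H_entry_sym)

lemma hess_outside: "i \<notin> nz_coords x \<Longrightarrow> (hess x *v v) $ i = 0"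
  by (simp add: matrix_vector_mult_def hessian_nz_def)

lemma hess_inside:
  assumes i: "i \<in> nz_coords x" and v: "\<And>j. j \<notin> nz_coords x \<Longrightarrow> v $ j = 0"
  shows "(hess x *v v) $ i = (H x *v v) $ i + lam * deriv (deriv r) \<bar>x $ i\<bar> * v $ i"
proof -
  have "hess x $ i $ j * v $ j = H x $ i $ j * v $ j
      + (if j = i then lam * deriv (deriv r) \<bar>x $ i\<bar> * v $ i else 0)" for j
    using i v[of j] by (auto simp: hessian_nz_def nz_coords_def hessian_entry algebra_simps)
  then show ?thesis by (simp add: matrix_vector_mult_def sum.distrib)
qed

section \<open>The linearized iteration at a stationary point\<close>

lemma DSx_zero:
  assumes "x $ i = 0"
  shows "DSx (x, 0) h $ i = 0"
  using assms by (simp add: DSx_def W_def w_def DW_def zero_prod_def)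

text \<open>Stationarity makes \<open>x $ i - g x $ i / \<beta>\<close> equal to sgn(x_i) times the
  denominator of \<open>w\<close>, which cancels one power of it in \<open>w'\<close>. What remains
  is a gradient step with the Hessian of the objective, r'' included. The direction \<open>e\<close>
  drops out, since the radius has zero derivative in e at e = 0.\<close>

lemma DSx_nonzero:
  assumes x: "x $ i \<noteq> 0" and st: "g x $ i = - lam * sgn (x $ i) * deriv r \<bar>x $ i\<bar>"
  shows "DSx (x, 0) (v, e) $ i = v $ i - ((H x *v v) $ i + lam * deriv (deriv r) \<bar>x $ i\<bar> * v $ i)
     / \<beta> / (1 + lam / \<beta> * deriv r \<bar>x $ i\<bar> / \<bar>x $ i\<bar>)"
proof -
  define t where "t = \<bar>x $ i\<bar>"
  define D where "D = t + lam / \<beta> * deriv r t"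
  have t: "t > 0" using x by (simp add: t_def)
  have D: "D > 0" unfolding D_def using t by (rule w_denom_pos)
  have n: "norm (x $ i, 0::real) = t" by (simp add: norm_Pair t_def)
  have W: "W (x $ i, 0) = t / D" unfolding W_def n by (simp add: w_def D_def)
  have ne: "(x $ i, 0::real) \<noteq> 0" using x by (simp add: zero_prod_def)
  have "sgn (x $ i, 0::real) \<bullet> (v $ i, e $ i) = sgn (x $ i) * v $ i"
    by (simp add: sgn_div_norm n t_def sgn_real_def abs_if)
  then have DW: "DW (x $ i, 0) (v $ i, e $ i) = w' t * (sgn (x $ i) * v $ i)"
    using ne by (simp add: DW_def t_def)
  have "x $ i = sgn (x $ i) * t" by (simp add: t_def sgn_if)
  then have "x $ i - g x $ i / \<beta> = sgn (x $ i) * t + lam * sgn (x $ i) * deriv r t / \<beta>"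
    by (simp add: st flip: t_def)
  also have "\<dots> = sgn (x $ i) * D" by (simp add: D_def distrib_left mult_ac)
  finally have y: "x $ i - g x $ i / \<beta> = sgn (x $ i) * D" .
  have sg: "sgn (x $ i) * sgn (x $ i) = 1" using x by (simp add: sgn_if)
  have "DSx (x, 0) (v, e) $ i = t / D * (v $ i - (H x *v v) $ i / \<beta>) + w' t * (sgn (x $ i) * v $ i) * (sgn (x $ i) * D)"
    by (simp add: DSx_def W DW y)
  also have "w' t * (sgn (x $ i) * v $ i) * (sgn (x $ i) * D) = w' t * D * v $ i"
    using sg by (metis (no_types, opaque_lifting) mult.assoc mult.commute mult_1)
  also have "w' t = lam / \<beta> * (deriv r t - t * deriv (deriv r) t) / D\<^sup>2"
    by (simp add: w'_def D_def)
  also have "lam / \<beta> * (deriv r t - t * deriv (deriv r) t) / D\<^sup>2 * D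
      = lam / \<beta> * (deriv r t - t * deriv (deriv r) t) / D"
    using D by (simp add: power2_eq_square)
  also have "t / D * (v $ i - (H x *v v) $ i / \<beta>) + lam / \<beta> * (deriv r t - t * deriv (deriv r) t) / D * v $ i
     = (v $ i * D - t * ((H x *v v) $ i / \<beta> + lam / \<beta> * deriv (deriv r) t * v $ i)) / D"
    by (simp add: D_def add_divide_distrib diff_divide_distrib algebra_simps)
  also have "\<dots> = v $ i - (t / D) * (((H x *v v) $ i + lam * deriv (deriv r) t * v $ i) / \<beta>)"
    using D by (simp add: diff_divide_distrib add_divide_distrib algebra_simps)
  also have "t / D = 1 / (1 + lam / \<beta> * deriv r t / t)"
  proof -
    have "D = t * (1 + lam / \<beta> * deriv r t / t)" using t by (simp add: D_def distrib_left)
    then show ?thesis using t by simp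
  qed
  finally show ?thesis by (simp add: t_def)
qed

text \<open>The linearization is block triangular: nonzero coordinates make a damped preconditioned
  gradient step, zero coordinates shrink by 1 - \<alpha> and feed into the former through
  \<open>C\<close>, and the smoothing parameters shrink by \<open>c\<close> without
  coupling.\<close>

lemma saddle_trapped_negligible:
  assumes x: "strict_saddle f r lam x" and \<rho>: "\<alpha> * onorm ((*v) (hess x)) \<le> \<beta>"
  shows "\<exists>U. open U \<and> (x, 0) \<in> U \<and> negligible {q. \<forall>k. (T ^^ k) q \<in> U}"
proof -
  define I where "I = nz_coords x"
  define P where "P = (\<lambda>v :: real ^ 'n. \<chi> i. if i \<in> I then v $ i else 0)"
  define M where "M v = (1 / \<beta>) *\<^sub>R (hess x *v v)" for v
  \<comment> \<open>On \<open>I\<close> this is the reciprocal of the reweighting factor; outside it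
    is filled with 1 so that \<open>D\<close> is at least 1 everywhere.\<close>
  define D where "D = (\<chi> i. if i \<in> I then 1 + lam / \<beta> * deriv r \<bar>x $ i\<bar> / \<bar>x $ i\<bar> else 1)"
  define C where "C v = (\<chi> i. if i \<in> I then - \<alpha> * ((H x *v v) $ i / \<beta> / D $ i) else 0)" for v
  have st: "stationary f r lam x" using x by (simp add: strict_saddle_def)
  obtain d0 where d0: "\<And>i. i \<notin> I \<Longrightarrow> d0 $ i = 0" "d0 \<bullet> (hess x *v d0) < 0"
    using x by (auto simp: strict_saddle_def I_def)
  have DT: "DT (x, 0) (v, e) = (P v - \<alpha> *\<^sub>R (\<chi> i. M (P v) $ i / D $ i) + C (v - P v) + (1 - \<alpha>) *\<^sub>R (v - P v), c *\<^sub>R e)" for v e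
  proof -
    have "(1 - \<alpha>) * v $ i + \<alpha> * DSx (x, 0) (v, e) $ i =
      P v $ i - \<alpha> * (M (P v) $ i / D $ i) + C (v - P v) $ i + (1 - \<alpha>) * (v $ i - P v $ i)" for i
    proof (cases "i \<in> I")
      case False
      then have "x $ i = 0" by (simp add: I_def nz_coords_def)
      then show ?thesis using False
        by (simp add: DSx_zero P_def C_def M_def hess_outside I_def)
    next
      case True
      let ?m = "lam * deriv (deriv r) \<bar>x $ i\<bar>"
      have "x $ i \<noteq> 0" "g x $ i = - lam * sgn (x $ i) * deriv r \<bar>x $ i\<bar>"
        using True st by (auto simp: I_def nz_coords_def stationary_def)
      from DSx_nonzero[OF this, of v e]
      have 1: "DSx (x, 0) (v, e) $ i = v $ i - ((H x *v v) $ i + ?m * v $ i) / \<beta> / D $ i"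
        using True by (simp add: D_def)
      have 2: "M (P v) $ i = ((H x *v P v) $ i + ?m * v $ i) / \<beta>"
        using True hess_inside[of i x "P v"] by (simp add: M_def I_def P_def)
      have 3: "C (v - P v) $ i = - \<alpha> * (((H x *v v) $ i - (H x *v P v) $ i) / \<beta> / D $ i)"
        using True by (simp add: C_def matrix_vector_mult_diff_distrib)
      have 4: "P v $ i = v $ i" using True by (simp add: P_def)
      show ?thesis unfolding 1 2 3 4 by (simp add: algebra_simps add_divide_distrib diff_divide_distrib)
    qed
    then show ?thesis by (simp add: DT_def vec_eq_iff)
  qed
  have "\<exists>b g d v. bounded_bilinear b \<and> g > (1::real) \<and> d > (0::real) \<and>
    (\<forall>h. b (DT (x, 0) h) (DT (x, 0) h) \<ge> g * b h h + d * (norm h)\<^sup>2) \<and> b v v > (0::real)"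
  proof (rule expanding_form[where M = M and C = C and D = D and I = I and \<alpha> = \<alpha> and c = c and A = "DT (x, 0)" and dneg = d0])
    show "linear M"
      unfolding M_def [abs_def] by (intro linear_compose_scale_right matrix_vector_mul_linear)
    show "M a \<bullet> b = a \<bullet> M b" for a b
      using symmetric_matrix_inner[of "hess x" a b] hess_sym by (simp add: M_def)
    show "linear C"
      by (rule linearI) (simp_all add: C_def vec_eq_iff matrix_vector_right_distrib
          matrix_vector_mult_scaleR add_divide_distrib distrib_left)
    show "M v $ i = 0" if "i \<notin> I" for v i
      using that by (simp add: M_def hess_outside I_def)
    show "C v $ i = 0" if "i \<notin> I" for v i
      using that by (simp add: C_def)
    show "1 \<le> D $ i" for i
      using r_deriv_nonneg[of "\<bar>x $ i\<bar>"] lam beta by (auto simp: D_def I_def nz_coords_def)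
    show "\<alpha> * (M v \<bullet> v) \<le> v \<bullet> v" for v
    proof -
      have "(hess x *v v) \<bullet> v \<le> norm (hess x *v v) * norm v" by (rule norm_cauchy_schwarz)
      also have "\<dots> \<le> onorm ((*v) (hess x)) * norm v * norm v"
        by (intro mult_right_mono onorm matrix_vector_mul_bounded_linear) auto
      finally have "\<alpha> * ((hess x *v v) \<bullet> v) \<le> \<alpha> * (onorm ((*v) (hess x)) * norm v * norm v)"
        using alpha by (intro mult_left_mono) auto
      also have "\<dots> = \<alpha> * onorm ((*v) (hess x)) * (v \<bullet> v)"
        by (simp add: power2_norm_eq_inner flip: power2_eq_square)
      also have "\<dots> \<le> \<beta> * (v \<bullet> v)" using \<rho> by (intro mult_right_mono) auto
      finally show ?thesis using beta by (simp add: M_def field_simps)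
    qed
    show "(\<chi> i. if i \<in> I then d0 $ i else 0) = d0" using d0(1) by (simp add: vec_eq_iff)
    show "M d0 \<bullet> d0 < 0"
      using d0(2) beta by (simp add: M_def inner_commute divide_neg_pos)
    show "DT (x, 0) (v, e) = ((\<chi> i. if i \<in> I then v $ i else 0)
        - \<alpha> *\<^sub>R (\<chi> i. M (\<chi> i. if i \<in> I then v $ i else 0) $ i / D $ i)
        + C (v - (\<chi> i. if i \<in> I then v $ i else 0)) + (1 - \<alpha>) *\<^sub>R (v - (\<chi> i. if i \<in> I then v $ i else 0)), c *\<^sub>R e)" for v e
      using DT[of v e] by (simp add: P_def)
  qed (use alpha c_bounds in blast)+
  then obtain b g d v where "bounded_bilinear b" "g > (1::real)" "d > (0::real)"
    "\<And>h. b (DT (x, 0) h) (DT (x, 0) h) \<ge> g * b h h + d * (norm h)\<^sup>2" "b v v > (0::real)" by blast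
  from negligible_trapped_set[OF T_strict this] show ?thesis .
qed

section \<open>From a single saddle to the whole set of attracted starting points\<close>

text \<open>The Hessian bound by \<open>\<rho>\<close> is available only in the level set of the
  starting point, so the limit has to be located there.\<close>

lemma limit_in_level_set:
  assumes e: "\<And>i. e $ i > 0" 
    and L: "L-lipschitz_on {y. F y \<le> FS x e} g" and \<beta>: "\<beta> > \<alpha> * L / 2"
    and lim: "(\<lambda>k. (T ^^ k) (x, e)) \<longlonglongrightarrow> (x', 0)"
  shows "F x' \<le> FS x e"
proof (rule LIMSEQ_le_const2)
  show "(\<lambda>k. F (fst ((T ^^ k) (x, e)))) \<longlonglongrightarrow> F x'"
    using isCont_tendsto_compose[OF F_isCont tendsto_fst[OF lim]] by simp
  show "\<exists>N. \<forall>k\<ge>N. F (fst ((T ^^ k) (x, e))) \<le> FS x e"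
    using orbit_level[OF e L \<beta>] F_le_FS order_trans by blast
qed

text \<open>Stands in for preimages under iterates of \<open>T\<close> on the orbits where
  \<open>x\<close> never moves.\<close>

lemma negligible_scaled_preimage:
  assumes "negligible N" "k \<noteq> 0"
  shows "negligible {q :: (real ^ 'n) \<times> (real ^ 'n). (fst q, k *\<^sub>R snd q) \<in> N}"
proof -
  let ?G = "\<lambda>q :: (real ^ 'n) \<times> (real ^ 'n). (fst q, k *\<^sub>R snd q)"
  have "bounded_linear ?G"
    by (intro bounded_linear_Pair bounded_linear_fst bounded_linear_const_scaleR bounded_linear_snd)
  then have "has_strict_derivative ?G ?G q" for q by (rule strict_derivative_linear)
  moreover have "inj ?G" using assms(2) by (auto simp: inj_def)
  ultimately have "negligible {q \<in> UNIV. ?G q \<in> N}"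
    using assms(1) by (intro negligible_preimage_strict_derivative) blast+
  then show ?thesis by simp
qed

end

context dirl2_setting
begin

lemma saddle_attracted_negligible:
  assumes e: "\<And>x e i. (x, e) \<in> P \<Longrightarrow> e $ i > 0"
    and L: "\<And>x e. (x, e) \<in> P \<Longrightarrow> \<exists>L. L-lipschitz_on {y. F y \<le> FS x e} g \<and> \<beta> > \<alpha> * L / 2"
    and \<rho>: "\<And>x e y. (x, e) \<in> P \<Longrightarrow> F y \<le> FS x e \<Longrightarrow> stationary f r lam y \<Longrightarrow>
        \<alpha> * onorm ((*v) (hess y)) \<le> \<beta>"
    and S: "\<And>x e. (x, e) \<in> P \<Longrightarrow> \<exists>L_S. L_S-lipschitz_on ({y. F y \<le> FS x e} \<times> cbox 0 e) (Smap f r lam \<beta> \<mu>)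
        \<and> \<alpha> < 1 / (1 + L_S)"
  shows "negligible {p \<in> P. \<exists>x. strict_saddle f r lam x \<and> (\<lambda>k. (T ^^ k) p) \<longlonglongrightarrow> (x, 0)}"
proof -
  \<comment> \<open>No level set occurs in \<open>Z\<close>, so one countable cover serves all
    starting points at once.\<close>
  define Z where "Z = {x. strict_saddle f r lam x \<and> \<alpha> * onorm ((*v) (hess x)) \<le> \<beta>}"
  define trapped where "trapped U = {q. \<forall>k. (T ^^ k) q \<in> U}" for U
  have "\<forall>x\<in>Z. \<exists>U. open U \<and> (x, 0) \<in> U \<and> negligible (trapped U)"
    using saddle_trapped_negligible by (simp add: Z_def trapped_def)
  from bchoice[OF this] obtain U
    where U: "\<And>x. x \<in> Z \<Longrightarrow> open (U x) \<and> (x, 0) \<in> U x \<and> negligible (trapped (U x))" by blast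
  obtain \<F> where \<F>: "\<F> \<subseteq> U ` Z" "countable \<F>" "\<Union>\<F> = \<Union>(U ` Z)"
    using Lindelof[of "U ` Z"] U by blast
  define escape where "escape m V = {q. (\<forall>i<m. \<exists>A. has_strict_derivative T A ((T ^^ i) q) \<and> inj A)
      \<and> (T ^^ m) q \<in> trapped V}" for m V
  define stay where "stay m V = {q. (fst q, c ^ m *\<^sub>R snd q) \<in> trapped V}" for m V
  have V: "negligible (trapped V)" if "V \<in> \<F>" for V using that \<F>(1) U by auto
  have "negligible (escape m V \<union> stay m V)" if "V \<in> \<F>" for m V
  proof (rule negligible_Un)
    show "negligible (escape m V)"
      unfolding escape_def using V[OF that] by (rule negligible_preimage_funpow)
    show "negligible (stay m V)"
      unfolding stay_def using V[OF that] c_bounds by (intro negligible_scaled_preimage) auto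
  qed
  then have "negligible (\<Union>((\<lambda>(m, V). escape m V \<union> stay m V) ` (UNIV \<times> \<F>)))"
    using \<F>(2) by (intro negligible_countable_Union) auto
  moreover have "p \<in> \<Union>((\<lambda>(m, V). escape m V \<union> stay m V) ` (UNIV \<times> \<F>))"
    if p: "p \<in> P" and x: "strict_saddle f r lam x" and lim: "(\<lambda>k. (T ^^ k) p) \<longlonglongrightarrow> (x, 0)" for p x
  proof -
    obtain x0 e0 where p0: "p = (x0, e0)" by fastforce
    have P0: "(x0, e0) \<in> P" using p p0 by simp
    have e0: "e0 $ i > 0" for i using e[OF P0] .
    obtain L where L0: "L-lipschitz_on {y. F y \<le> FS x0 e0} g" "\<beta> > \<alpha> * L / 2" using L[OF P0] by blast
    obtain L_S where S0: "L_S-lipschitz_on ({y. F y \<le> FS x0 e0} \<times> cbox 0 e0) (Smap f r lam \<beta> \<mu>)"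
      "\<alpha> < 1 / (1 + L_S)" using S[OF P0] by blast
    have "F x \<le> FS x0 e0" using limit_in_level_set[OF e0 L0] lim p0 by simp
    then have "x \<in> Z" using \<rho>[OF P0] x by (simp add: Z_def strict_saddle_def)
    then have "(x, 0) \<in> \<Union>\<F>" using U \<F>(3) by blast
    then obtain V where V: "V \<in> \<F>" "(x, 0) \<in> V" by blast
    have "open V" using V(1) \<F>(1) U by auto
    then have "\<forall>\<^sub>F k in sequentially. (T ^^ k) p \<in> V" using lim V(2) topological_tendstoD by blast
    then obtain m where later: "\<And>k. k \<ge> m \<Longrightarrow> (T ^^ k) p \<in> V" by (auto simp: eventually_sequentially)
    have "(T ^^ k) ((T ^^ m) p) \<in> V" for k using later[of "k + m"] by (simp add: funpow_add)
    then have m: "(T ^^ m) p \<in> trapped V" by (simp add: trapped_def)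
    from orbit_dichotomy[OF e0 L0 S0] have "p \<in> escape m V \<union> stay m V"
    proof
      assume "\<forall>k. (T ^^ k) (x0, e0) = (x0, c ^ k *\<^sub>R e0)"
      then show ?thesis using m by (simp add: stay_def p0)
    next
      assume "\<forall>k. inj (DT ((T ^^ k) (x0, e0)))"
      then have "\<forall>i<m. \<exists>A. has_strict_derivative T A ((T ^^ i) p) \<and> inj A" using T_strict p0 by blast
      then show ?thesis using m by (simp add: escape_def)
    qed
    with V(1) show ?thesis by auto
  qed
  ultimately show ?thesis by (elim negligible_subset) blast
qed

end

text \<open>Fixed \<alpha>, \<beta>, \<mu> are admissible only for some starting points, as the
  level set and its constants vary with the point. \<open>P\<close> is any set of such points;
  completeness of Lebesgue measure supplies the measurability contained in the conclusion.\<close>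

theorem theorem4p7:
  fixes f :: "real ^ 'n::finite \<Rightarrow> real"
    and r :: "real \<Rightarrow> real"
    and lam \<alpha> \<beta> \<mu> :: real
    and P :: "((real ^ 'n) \<times> (real ^ 'n)) set"
    and L \<rho> L_S :: "(real ^ 'n) \<times> (real ^ 'n) \<Rightarrow> real"
  assumes "twice_cont_diff f"
    and "lam > 0"
    and "A1 r"
    and "A2 f r lam"
    and "A4 r"
    and "strict_saddle_property f r lam"
    and "\<alpha> \<in> {0<..<1}"
    and "\<mu> \<in> {0<..<1}"
    and "\<And>x0 e0. (x0, e0) \<in> P \<Longrightarrow> \<forall>i. e0 $ i > 0"
    and "\<And>x0 e0. (x0, e0) \<in> P \<Longrightarrow> A3 f r lam x0 e0"
    and "\<And>x0 e0. (x0, e0) \<in> P \<Longrightarrow>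
           (L (x0, e0))-lipschitz_on (level_set f r lam x0 e0) (gradient f)
           \<and> \<beta> > \<alpha> * L (x0, e0) / 2"
    and "\<And>x0 e0. (x0, e0) \<in> P \<Longrightarrow>
           \<rho> (x0, e0) > 0 \<and>
           (\<forall>x \<in> level_set f r lam x0 e0. stationary f r lam x \<longrightarrow>
              onorm ((*v) (hessian_nz f r lam x)) \<le> \<rho> (x0, e0)) \<and>
           \<alpha> < \<beta> / \<rho> (x0, e0)"
    and "\<And>x0 e0. (x0, e0) \<in> P \<Longrightarrow>
           (L_S (x0, e0))-lipschitz_on (lip_domain f r lam x0 e0) (Smap f r lam \<beta> \<mu>)
           \<and> \<alpha> \<in> {0 <..< 1 / (1 + L_S (x0, e0))}"
  shows "{p \<in> P. \<exists>x. strict_saddle f r lam x \<and> dirl2 f r lam \<alpha> \<beta> \<mu> p \<longlonglongrightarrow> (x, 0)}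
           \<in> null_sets lebesgue"
proof (cases "P = {}")
  case False
  note hyps = assms
  \<comment> \<open>Positivity of \<beta> is read off from
    \<open>\<alpha> < \<beta> / \<rho>\<close> at some point of \<open>P\<close>, hence the case
    split on \<open>P\<close>.\<close>
  obtain x1 e1 where P1: "(x1, e1) \<in> P" using False by fastforce
  have "\<rho> (x1, e1) > 0" "\<alpha> < \<beta> / \<rho> (x1, e1)" using hyps(12)[OF P1] by auto
  moreover have "\<alpha> > 0" using hyps(7) by simp
  ultimately have beta: "\<beta> > 0" by (metis less_trans zero_less_divide_iff not_less_iff_gr_or_eq)
  obtain H where H: "\<And>x. (gradient f has_derivative (\<lambda>h. H x *v h)) (at x)" "continuous_on UNIV H"
    using hyps(1) unfolding twice_cont_diff_def by blast
  interpret dirl2_setting f r lam \<alpha> \<beta> \<mu> H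
    using hyps beta H by unfold_locales (auto simp: twice_cont_diff_def)
  have "negligible {p \<in> P. \<exists>x. strict_saddle f r lam x \<and> (\<lambda>k. (T ^^ k) p) \<longlonglongrightarrow> (x, 0)}"
  proof (rule saddle_attracted_negligible)
    fix x e assume xe: "(x, e) \<in> P"
    show "e $ i > 0" for i using hyps(9)[OF xe] by simp
    show "\<exists>L. L-lipschitz_on {y. F y \<le> FS x e} g \<and> \<beta> > \<alpha> * L / 2"
      using hyps(11)[OF xe] unfolding level_set_def by blast
    show "\<exists>L_S. L_S-lipschitz_on ({y. F y \<le> FS x e} \<times> cbox 0 e) (Smap f r lam \<beta> \<mu>) \<and> \<alpha> < 1 / (1 + L_S)"
      using hyps(13)[OF xe] unfolding lip_domain_def level_set_def by auto
    fix y assume "F y \<le> FS x e" "stationary f r lam y"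
    then have le: "onorm ((*v) (hess y)) \<le> \<rho> (x, e)" "\<rho> (x, e) > 0" "\<alpha> < \<beta> / \<rho> (x, e)"
      using hyps(12)[OF xe] by (auto simp: level_set_def)
    then have "\<alpha> * onorm ((*v) (hess y)) \<le> \<alpha> * \<rho> (x, e)" using hyps(7) by (intro mult_left_mono) auto
    also have "\<dots> \<le> \<beta>" using le by (simp add: pos_less_divide_eq less_imp_le)
    finally show "\<alpha> * onorm ((*v) (hess y)) \<le> \<beta>" .
  qed
  moreover have "dirl2 f r lam \<alpha> \<beta> \<mu> p = (\<lambda>k. (T ^^ k) p)" for p
    by (simp add: dirl2_def [abs_def])
  ultimately show ?thesis by (simp add: negligible_iff_null_sets)
qed simp

end
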